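(* Let $C=\langle e_1g_1(x),e_2g_2(x),e_3g_3(x)\rangle$ be a cyclic code of length $n$ over $R$, where $\gcd(n,p)=1$, and where $C_i=\langle g_i\rangle$ with $g_i$ an idempotent of $\mathbb{F}_{p^k}[x]/(x^n-1)$ for $i=1,2,3$. Then $C=\langle e_1g_1(x)+e_2g_2(x)+e_3g_3(x)\rangle$, and the idempotent generator of $C^{\perp}$ is $1-e_1g_1(x^{-1})-e_2g_2(x^{-1})-e_3g_3(x^{-1})$.
   Context: Let $p$ be a prime, $k\ge1$ and $r>1$ integers with $\gcd(r,p)=1$, and $R_r=\mathbb{F}_{p^k}[v]/\langle v^{r+1}-v\rangle$. In $R_r$ put $e_1=\frac1r(v+v^2+\dots+v^r)$, $e_2=-\frac1r(v+\dots+v^{r-1})+\frac{r-1}{r}v^r$, $e_3=1-v^r$; these are nonzero orthogonal idempotents with sum $1$. $R$ denotes the subring $R=e_1\mathbb{F}_{p^k}\oplus e_2\mathbb{F}_{p^k}\oplus e_3\mathbb{F}_{p^k}$ of $R_r$. A cyclic code of length $n$ over a commutative ring $A$ is an $A$-submodule of $A^n$ stable under $(c_0,\dots,c_{n-1})\mapsto(c_{n-1},c_0,\dots,c_{n-2})$; identifying $(c_0,\dots,c_{n-1})$ with $\sum c_ix^i$, cyclic codes are the ideals of $A[x]/(x^n-1)$, and $\langle\cdot\rangle$ denotes the ideal generated. The dual is $C^\perp=\{y\in R^n : \sum_j y_jc_j=0\ \forall c\in C\}$. The idempotent generator of a cyclic code is the idempotent generating it as an ideal. The associated codes of $C$ are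 $C_1=\{s : \exists\, t,u\in\mathbb{F}_{p^k}^n,\ e_1s+e_2t+e_3u\in C\}$, $C_2=\{t : \exists\, s,u\in\mathbb{F}_{p^k}^n,\ e_1s+e_2t+e_3u\in C\}$, $C_3=\{u : \exists\, s,t\in\mathbb{F}_{p^k}^n,\ e_1s+e_2t+e_3u\in C\}$. In $A[x]/(x^n-1)$, $x^{-1}=x^{n-1}$ and $g(x^{-1})$ is the image of $g(x)$ under $x\mapsto x^{-1}$. *)

theory Defs
  imports "HOL-Algebra.UnivPoly" "HOL-Algebra.QuotRing" "HOL-Computational_Algebra.Primes"
begin

section \<open>Quotients of univariate polynomial rings\<close>

definition poly_quot :: "('a, 'm) ring_scheme \<Rightarrow> (nat \<Rightarrow> 'a) \<Rightarrow> (nat \<Rightarrow> 'a) set ring"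
  where "poly_quot A f = UP A Quot (Idl\<^bsub>UP A\<^esub> {f})"

definition poly_class :: "('a, 'm) ring_scheme \<Rightarrow> (nat \<Rightarrow> 'a) \<Rightarrow> (nat \<Rightarrow> 'a) \<Rightarrow> (nat \<Rightarrow> 'a) set"
  where "poly_class A f g = (Idl\<^bsub>UP A\<^esub> {f}) +>\<^bsub>UP A\<^esub> g"

text \<open>The map \<open>A[x]/(f) \<rightarrow> S\<close> induced by \<open>\<phi> : A \<rightarrow> S\<close> and \<open>x \<mapsto> s\<close>. It is meaningful when
  evaluation is constant on residue classes; then \<open>eval A S \<phi> s ` G\<close> is a singleton for
  every residue class \<open>G\<close>.\<close>

definition induced_eval ::
    "('a, 'm) ring_scheme \<Rightarrow> ('b, 'n) ring_scheme \<Rightarrow> ('a \<Rightarrow> 'b) \<Rightarrow> 'b \<Rightarrow> (nat \<Rightarrow> 'a) set \<Rightarrow> 'b"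
  where "induced_eval A S \<phi> s G = the_elem (eval A S \<phi> s ` G)"


section \<open>The ring of cyclic codes\<close>

definition cyc_modulus :: "('a, 'm) ring_scheme \<Rightarrow> nat \<Rightarrow> nat \<Rightarrow> 'a"
  where "cyc_modulus A n = monom (UP A) \<one>\<^bsub>A\<^esub> n \<ominus>\<^bsub>UP A\<^esub> \<one>\<^bsub>UP A\<^esub>"

definition cyc_ring :: "('a, 'm) ring_scheme \<Rightarrow> nat \<Rightarrow> (nat \<Rightarrow> 'a) set ring"
  where "cyc_ring A n = poly_quot A (cyc_modulus A n)"

definition cyc_const :: "('a, 'm) ring_scheme \<Rightarrow> nat \<Rightarrow> 'a \<Rightarrow> (nat \<Rightarrow> 'a) set"
  where "cyc_const A n a = poly_class A (cyc_modulus A n) (monom (UP A) a 0)"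

definition cyc_x :: "('a, 'm) ring_scheme \<Rightarrow> nat \<Rightarrow> (nat \<Rightarrow> 'a) set"
  where "cyc_x A n = poly_class A (cyc_modulus A n) (monom (UP A) \<one>\<^bsub>A\<^esub> 1)"

text \<open>\<open>g(x) \<mapsto> g(x\<^sup>-\<^sup>1)\<close>, where \<open>x\<^sup>-\<^sup>1 = x\<^sup>n\<^sup>-\<^sup>1\<close>.\<close>

definition cyc_inv :: "('a, 'm) ring_scheme \<Rightarrow> nat \<Rightarrow> (nat \<Rightarrow> 'a) set \<Rightarrow> (nat \<Rightarrow> 'a) set"
  where "cyc_inv A n =
    induced_eval A (cyc_ring A n) (cyc_const A n) (cyc_x A n [^]\<^bsub>cyc_ring A n\<^esub> (n - 1))"


section \<open>Codes as sets of words\<close>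

text \<open>The module \<open>A\<^sup>n\<close>; words are extensional functions on \<open>{..<n}\<close>.
  The componentwise \<open>mult\<close> and \<open>one\<close> only fill the fields of the record.\<close>

definition word_module :: "('a, 'm) ring_scheme \<Rightarrow> nat \<Rightarrow> ('a, nat \<Rightarrow> 'a) module"
  where "word_module A n = \<lparr>
    carrier = {..<n} \<rightarrow>\<^sub>E carrier A,
    monoid.mult = (\<lambda>x y. \<lambda>i\<in>{..<n}. x i \<otimes>\<^bsub>A\<^esub> y i),
    one = (\<lambda>i\<in>{..<n}. \<one>\<^bsub>A\<^esub>),
    zero = (\<lambda>i\<in>{..<n}. \<zero>\<^bsub>A\<^esub>),
    add = (\<lambda>x y. \<lambda>i\<in>{..<n}. x i \<oplus>\<^bsub>A\<^esub> y i),
    smult = (\<lambda>a x. \<lambda>i\<in>{..<n}. a \<otimes>\<^bsub>A\<^esub> x i)\<rparr>"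

definition cyc_shift :: "nat \<Rightarrow> (nat \<Rightarrow> 'a) \<Rightarrow> nat \<Rightarrow> 'a"
  where "cyc_shift n c = (\<lambda>i\<in>{..<n}. if i = 0 then c (n - 1) else c (i - 1))"

definition cyclic_code :: "('a, 'm) ring_scheme \<Rightarrow> nat \<Rightarrow> (nat \<Rightarrow> 'a) set \<Rightarrow> bool"
  where "cyclic_code A n C \<longleftrightarrow> submodule C A (word_module A n) \<and> cyc_shift n ` C \<subseteq> C"

definition word_class :: "('a, 'm) ring_scheme \<Rightarrow> nat \<Rightarrow> (nat \<Rightarrow> 'a) \<Rightarrow> (nat \<Rightarrow> 'a) set"
  where "word_class A n c =
    poly_class A (cyc_modulus A n) (\<Oplus>\<^bsub>UP A\<^esub>i\<in>{..<n}. monom (UP A) (c i) i)"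

text \<open>\<open>C = \<langle>G\<rangle>\<close>, for a set of words \<open>C\<close> and a set \<open>G\<close> of elements of \<open>A[x]/(x\<^sup>n - 1)\<close>.\<close>

definition code_generated_by ::
    "('a, 'm) ring_scheme \<Rightarrow> nat \<Rightarrow> (nat \<Rightarrow> 'a) set \<Rightarrow> (nat \<Rightarrow> 'a) set set \<Rightarrow> bool"
  where "code_generated_by A n C G \<longleftrightarrow> word_class A n ` C = Idl\<^bsub>cyc_ring A n\<^esub> G"

definition dual_code :: "('a, 'm) ring_scheme \<Rightarrow> nat \<Rightarrow> (nat \<Rightarrow> 'a) set \<Rightarrow> (nat \<Rightarrow> 'a) set"
  where "dual_code A n C =
    {y \<in> carrier (word_module A n). \<forall>c\<in>C. (\<Oplus>\<^bsub>A\<^esub>j\<in>{..<n}. y j \<otimes>\<^bsub>A\<^esub> c j) = \<zero>\<^bsub>A\<^esub>}"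

definition cyc_idempotent :: "('a, 'm) ring_scheme \<Rightarrow> nat \<Rightarrow> (nat \<Rightarrow> 'a) set \<Rightarrow> bool"
  where "cyc_idempotent A n g \<longleftrightarrow>
    g \<in> carrier (cyc_ring A n) \<and> g \<otimes>\<^bsub>cyc_ring A n\<^esub> g = g"

definition idempotent_generator ::
    "('a, 'm) ring_scheme \<Rightarrow> nat \<Rightarrow> (nat \<Rightarrow> 'a) set \<Rightarrow> (nat \<Rightarrow> 'a) set \<Rightarrow> bool"
  where "idempotent_generator A n C g \<longleftrightarrow>
    cyclic_code A n C \<and> cyc_idempotent A n g \<and> code_generated_by A n C {g}"


section \<open>The rings \<open>F[v]/(v\<^sup>r\<^sup>+\<^sup>1 - v)\<close> and \<open>e\<^sub>1F \<oplus> e\<^sub>2F \<oplus> e\<^sub>3F\<close>\<close>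

definition R_modulus :: "('a, 'm) ring_scheme \<Rightarrow> nat \<Rightarrow> nat \<Rightarrow> 'a"
  where "R_modulus F r = monom (UP F) \<one>\<^bsub>F\<^esub> (r + 1) \<ominus>\<^bsub>UP F\<^esub> monom (UP F) \<one>\<^bsub>F\<^esub> 1"

definition R_full :: "('a, 'm) ring_scheme \<Rightarrow> nat \<Rightarrow> (nat \<Rightarrow> 'a) set ring"
  where "R_full F r = poly_quot F (R_modulus F r)"

definition R_const :: "('a, 'm) ring_scheme \<Rightarrow> nat \<Rightarrow> 'a \<Rightarrow> (nat \<Rightarrow> 'a) set"
  where "R_const F r a = poly_class F (R_modulus F r) (monom (UP F) a 0)"

definition R_v :: "('a, 'm) ring_scheme \<Rightarrow> nat \<Rightarrow> (nat \<Rightarrow> 'a) set"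
  where "R_v F r = poly_class F (R_modulus F r) (monom (UP F) \<one>\<^bsub>F\<^esub> 1)"

definition e1 :: "('a, 'm) ring_scheme \<Rightarrow> nat \<Rightarrow> (nat \<Rightarrow> 'a) set"
  where "e1 F r = R_const F r (inv\<^bsub>F\<^esub> ([r] \<cdot>\<^bsub>F\<^esub> \<one>\<^bsub>F\<^esub>)) \<otimes>\<^bsub>R_full F r\<^esub>
    (\<Oplus>\<^bsub>R_full F r\<^esub>j\<in>{1..r}. R_v F r [^]\<^bsub>R_full F r\<^esub> j)"

definition e2 :: "('a, 'm) ring_scheme \<Rightarrow> nat \<Rightarrow> (nat \<Rightarrow> 'a) set"
  where "e2 F r =
    (\<ominus>\<^bsub>R_full F r\<^esub> (R_const F r (inv\<^bsub>F\<^esub> ([r] \<cdot>\<^bsub>F\<^esub> \<one>\<^bsub>F\<^esub>)) \<otimes>\<^bsub>R_full F r\<^esub>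
      (\<Oplus>\<^bsub>R_full F r\<^esub>j\<in>{1..r - 1}. R_v F r [^]\<^bsub>R_full F r\<^esub> j)))
    \<oplus>\<^bsub>R_full F r\<^esub>
    R_const F r (([(r - 1)] \<cdot>\<^bsub>F\<^esub> \<one>\<^bsub>F\<^esub>) \<otimes>\<^bsub>F\<^esub> inv\<^bsub>F\<^esub> ([r] \<cdot>\<^bsub>F\<^esub> \<one>\<^bsub>F\<^esub>)) \<otimes>\<^bsub>R_full F r\<^esub>
      R_v F r [^]\<^bsub>R_full F r\<^esub> r"

definition e3 :: "('a, 'm) ring_scheme \<Rightarrow> nat \<Rightarrow> (nat \<Rightarrow> 'a) set"
  where "e3 F r = \<one>\<^bsub>R_full F r\<^esub> \<ominus>\<^bsub>R_full F r\<^esub> R_v F r [^]\<^bsub>R_full F r\<^esub> r"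

definition e_comb :: "('a, 'm) ring_scheme \<Rightarrow> nat \<Rightarrow> 'a \<Rightarrow> 'a \<Rightarrow> 'a \<Rightarrow> (nat \<Rightarrow> 'a) set"
  where "e_comb F r a b c =
    e1 F r \<otimes>\<^bsub>R_full F r\<^esub> R_const F r a \<oplus>\<^bsub>R_full F r\<^esub>
    e2 F r \<otimes>\<^bsub>R_full F r\<^esub> R_const F r b \<oplus>\<^bsub>R_full F r\<^esub>
    e3 F r \<otimes>\<^bsub>R_full F r\<^esub> R_const F r c"

definition R_sub :: "('a, 'm) ring_scheme \<Rightarrow> nat \<Rightarrow> (nat \<Rightarrow> 'a) set ring"
  where "R_sub F r = (R_full F r)
    \<lparr>carrier := {e_comb F r a b c |a b c. a \<in> carrier F \<and> b \<in> carrier F \<and> c \<in> carrier F}\<rparr>"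

definition e_word ::
    "('a, 'm) ring_scheme \<Rightarrow> nat \<Rightarrow> nat \<Rightarrow> (nat \<Rightarrow> 'a) \<Rightarrow> (nat \<Rightarrow> 'a) \<Rightarrow> (nat \<Rightarrow> 'a) \<Rightarrow>
      nat \<Rightarrow> (nat \<Rightarrow> 'a) set"
  where "e_word F r n s t u = (\<lambda>j\<in>{..<n}. e_comb F r (s j) (t j) (u j))"

definition assoc_code1 ::
    "('a, 'm) ring_scheme \<Rightarrow> nat \<Rightarrow> nat \<Rightarrow> (nat \<Rightarrow> (nat \<Rightarrow> 'a) set) set \<Rightarrow> (nat \<Rightarrow> 'a) set"
  where "assoc_code1 F r n C =
    {s \<in> carrier (word_module F n).
      \<exists>t\<in>carrier (word_module F n). \<exists>u\<in>carrier (word_module F n). e_word F r n s t u \<in> C}"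

definition assoc_code2 ::
    "('a, 'm) ring_scheme \<Rightarrow> nat \<Rightarrow> nat \<Rightarrow> (nat \<Rightarrow> (nat \<Rightarrow> 'a) set) set \<Rightarrow> (nat \<Rightarrow> 'a) set"
  where "assoc_code2 F r n C =
    {t \<in> carrier (word_module F n).
      \<exists>s\<in>carrier (word_module F n). \<exists>u\<in>carrier (word_module F n). e_word F r n s t u \<in> C}"

definition assoc_code3 ::
    "('a, 'm) ring_scheme \<Rightarrow> nat \<Rightarrow> nat \<Rightarrow> (nat \<Rightarrow> (nat \<Rightarrow> 'a) set) set \<Rightarrow> (nat \<Rightarrow> 'a) set"
  where "assoc_code3 F r n C =
    {u \<in> carrier (word_module F n).
      \<exists>s\<in>carrier (word_module F n). \<exists>t\<in>carrier (word_module F n). e_word F r n s t u \<in> C}"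

text \<open>For \<open>e \<in> R\<close> and \<open>g \<in> F[x]/(x\<^sup>n - 1)\<close>, the element \<open>e g(x)\<close> of \<open>R[x]/(x\<^sup>n - 1)\<close>: the image of
  \<open>g\<close> under the extension of scalars along \<open>F \<rightarrow> R\<close>, times the constant \<open>e\<close>.\<close>

definition lift_mult ::
    "('a, 'm) ring_scheme \<Rightarrow> nat \<Rightarrow> nat \<Rightarrow> (nat \<Rightarrow> 'a) set \<Rightarrow> (nat \<Rightarrow> 'a) set \<Rightarrow>
      (nat \<Rightarrow> (nat \<Rightarrow> 'a) set) set"
  where "lift_mult F r n e g =
    cyc_const (R_sub F r) n e \<otimes>\<^bsub>cyc_ring (R_sub F r) n\<^esub>
    induced_eval F (cyc_ring (R_sub F r) n) (\<lambda>a. cyc_const (R_sub F r) n (R_const F r a))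
      (cyc_x (R_sub F r) n) g"

end

theory Submission
  imports Defs "HOL-Algebra.Subrings"
begin

text \<open>
  Write \<open>g*\<close> for \<open>g(x\<^sup>-\<^sup>1)\<close>. Over any commutative ring \<open>A\<close> the inner product of two words is the constant
  coefficient of \<open>y c*\<close> in \<open>A[x]/(x\<^sup>n - 1)\<close>. If \<open>C = \<langle>g\<rangle>\<close> with \<open>g\<close> idempotent, applying this to all the
  shifts of \<open>g\<close> shows that \<open>y\<close> lies in the dual iff \<open>y g* = 0\<close>, that is, iff \<open>y \<in> \<langle>1 - g*\<rangle>\<close>.
  This is used directly over \<open>R\<close> with \<open>g = e\<^sub>1g\<^sub>1 + e\<^sub>2g\<^sub>2 + e\<^sub>3g\<^sub>3\<close>: as the \<open>e\<^sub>i\<close> are orthogonal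
  idempotents, \<open>g\<close> is idempotent and \<open>e\<^sub>i g = e\<^sub>i g\<^sub>i\<close>, so \<open>g\<close> generates \<open>C\<close>. Orthogonality of the \<open>e\<^sub>i\<close> comes
  from \<open>e\<^sub>2 = v\<^sup>r - e\<^sub>1\<close> and \<open>e\<^sub>3 = 1 - v\<^sup>r\<close>, where \<open>e\<^sub>1\<close> and \<open>v\<^sup>r\<close> are idempotents with \<open>e\<^sub>1 v\<^sup>r = e\<^sub>1\<close>.
\<close>

section \<open>Polynomial quotients\<close>

lemma poly_class_hom:
  assumes "cring A" "f \<in> carrier (UP A)"
  shows "ring_hom_cring (UP A) (poly_quot A f) (poly_class A f)"
proof -
  interpret UP_cring A "UP A" using assms by (simp add: UP_cring_def)
  interpret ideal "Idl\<^bsub>UP A\<^esub> {f}" "UP A"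
    using assms(2) by (auto intro: P.genideal_ideal)
  show ?thesis
    using rcos_ring_hom_cring P.is_cring by (simp add: poly_quot_def poly_class_def[abs_def])
qed

lemma poly_class_surj:
  assumes "cring A" "f \<in> carrier (UP A)" "G \<in> carrier (poly_quot A f)"
  obtains p where "p \<in> carrier (UP A)" "G = poly_class A f p"
  using assms(3) by (auto simp: poly_quot_def poly_class_def FactRing_def A_RCOSETS_def')

text \<open>A class is zero exactly on the ideal of \<open>f\<close>. As \<open>UP A\<close> is
  commutative, this ideal consists of the multiples of \<open>f\<close>.\<close>

lemma poly_class_eq_zeroD:
  assumes "cring A" "f \<in> carrier (UP A)" "p \<in> carrier (UP A)"
    "poly_class A f p = \<zero>\<^bsub>poly_quot A f\<^esub>"
  obtains q where "q \<in> carrier (UP A)" "p = q \<otimes>\<^bsub>UP A\<^esub> f"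
proof -
  interpret UP_cring A "UP A" using assms by (simp add: UP_cring_def)
  interpret ideal "Idl\<^bsub>UP A\<^esub> {f}" "UP A"
    using assms(2) by (auto intro: P.genideal_ideal)
  have "p \<in> Idl\<^bsub>UP A\<^esub> {f}"
    using assms(3,4) by (metis FactRing_def a_rcos_self poly_class_def poly_quot_def ring.simps(1))
  then show ?thesis
    using P.cgenideal_eq_genideal[OF assms(2)] that by (auto simp: cgenideal_def)
qed

lemma poly_class_modulus:
  assumes "cring A" "f \<in> carrier (UP A)"
  shows "poly_class A f f = \<zero>\<^bsub>poly_quot A f\<^esub>"
proof -
  interpret UP_cring A "UP A" using assms by (simp add: UP_cring_def)
  interpret ideal "Idl\<^bsub>UP A\<^esub> {f}" "UP A"
    using assms(2) by (auto intro: P.genideal_ideal)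
  show ?thesis
    using P.genideal_self'[OF assms(2)] a_rcos_const
    by (simp add: poly_class_def poly_quot_def FactRing_def)
qed

text \<open>Two representatives of a class differ by a multiple of \<open>f\<close>, which
  evaluation kills. The image of the class is therefore a singleton, and \<open>the_elem\<close>
  picks the intended value.\<close>

lemma induced_eval_poly_class:
  assumes "ring_hom_cring A S \<phi>" "s \<in> carrier S" "f \<in> carrier (UP A)"
    "eval A S \<phi> s f = \<zero>\<^bsub>S\<^esub>" "p \<in> carrier (UP A)"
  shows "induced_eval A S \<phi> s (poly_class A f p) = eval A S \<phi> s p"
proof -
  interpret UP_univ_prop A S \<phi> "UP A" s "eval A S \<phi> s"
    using assms by (simp_all add: UP_univ_prop_def UP_pre_univ_prop_def UP_univ_prop_axioms_def
        UP_cring_def ring_hom_cring_def)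
  interpret I: ideal "Idl\<^bsub>UP A\<^esub> {f}" "UP A"
    using assms(3) by (auto intro: P.genideal_ideal)
  have "eval A S \<phi> s p' = eval A S \<phi> s p" if "p' \<in> poly_class A f p" for p'
  proof -
    obtain h where h: "h \<in> Idl\<^bsub>UP A\<^esub> {f}" "p' = h \<oplus>\<^bsub>UP A\<^esub> p"
      using \<open>p' \<in> _\<close> by (auto simp: poly_class_def a_r_coset_def r_coset_def)
    then obtain q where "q \<in> carrier (UP A)" "h = q \<otimes>\<^bsub>UP A\<^esub> f"
      using P.cgenideal_eq_genideal[OF assms(3)] by (auto simp: cgenideal_def)
    then show ?thesis using h assms by simp
  qed
  \<comment> \<open>Constancy alone would allow an empty image; membership of \<open>p\<close> makes
    it a singleton.\<close>
  moreover have "p \<in> poly_class A f p"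
    using I.a_rcos_self assms(5) by (simp add: poly_class_def)
  ultimately have "eval A S \<phi> s ` poly_class A f p = {eval A S \<phi> s p}" by blast
  then show ?thesis by (simp add: induced_eval_def)
qed

lemma induced_eval_hom:
  assumes "ring_hom_cring A S \<phi>" "s \<in> carrier S" "f \<in> carrier (UP A)"
    "eval A S \<phi> s f = \<zero>\<^bsub>S\<^esub>"
  shows "ring_hom_cring (poly_quot A f) S (induced_eval A S \<phi> s)"
proof -
  interpret UP_univ_prop A S \<phi> "UP A" s "eval A S \<phi> s"
    using assms by (simp_all add: UP_univ_prop_def UP_pre_univ_prop_def UP_univ_prop_axioms_def
        UP_cring_def ring_hom_cring_def)
  interpret cl: ring_hom_cring "UP A" "poly_quot A f" "poly_class A f"
    using assms R.is_cring by (intro poly_class_hom)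
  note ev = induced_eval_poly_class[OF assms]
  show ?thesis
  proof (intro ring_hom_cring.intro ring_hom_cring_axioms.intro ring_hom_memI)
    fix x assume "x \<in> carrier (poly_quot A f)"
    then obtain p where p: "p \<in> carrier (UP A)" "x = poly_class A f p"
      using poly_class_surj R.is_cring assms(3) by metis
    then show "induced_eval A S \<phi> s x \<in> carrier S" by (simp add: ev)
    fix y assume "y \<in> carrier (poly_quot A f)"
    then obtain q where q: "q \<in> carrier (UP A)" "y = poly_class A f q"
      using poly_class_surj R.is_cring assms(3) by metis
    show "induced_eval A S \<phi> s (x \<otimes>\<^bsub>poly_quot A f\<^esub> y) =
        induced_eval A S \<phi> s x \<otimes>\<^bsub>S\<^esub> induced_eval A S \<phi> s y"
      unfolding p q using p(1) q(1) ev[of "p \<otimes>\<^bsub>UP A\<^esub> q"] by (simp add: ev)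
    show "induced_eval A S \<phi> s (x \<oplus>\<^bsub>poly_quot A f\<^esub> y) =
        induced_eval A S \<phi> s x \<oplus>\<^bsub>S\<^esub> induced_eval A S \<phi> s y"
      unfolding p q using p(1) q(1) ev[of "p \<oplus>\<^bsub>UP A\<^esub> q"] by (simp add: ev)
  next
    show "induced_eval A S \<phi> s \<one>\<^bsub>poly_quot A f\<^esub> = \<one>\<^bsub>S\<^esub>"
      using ev[of "\<one>\<^bsub>UP A\<^esub>"] by simp
  qed (rule cl.S.is_cring S.is_cring)+
qed

section \<open>Cyclic codes over a commutative ring\<close>

locale cyc = cring A for A (structure) +
  fixes n :: nat
  assumes n_pos: "0 < n"
begin

abbreviation Q where "Q \<equiv> cyc_ring A n"
abbreviation K where "K \<equiv> cyc_const A n"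
abbreviation X where "X \<equiv> cyc_x A n"
abbreviation wc where "wc \<equiv> word_class A n"
abbreviation words where "words \<equiv> {..<n} \<rightarrow>\<^sub>E carrier A"

section \<open>The ring A[x]/(x^n - 1) and its relation x^n = 1\<close>

sublocale U: UP_cring A "UP A"
  by (simp_all add: UP_cring_def is_cring)

lemma cyc_modulus_closed: "cyc_modulus A n \<in> carrier (UP A)"
  by (simp add: cyc_modulus_def)

sublocale cl: ring_hom_cring "UP A" Q "poly_class A (cyc_modulus A n)"
  using poly_class_hom[OF is_cring cyc_modulus_closed] by (simp add: cyc_ring_def)

lemma K_hom: "ring_hom_cring A Q K"
proof -
  have "(\<lambda>a. poly_class A (cyc_modulus A n) (monom (UP A) a 0)) \<in> ring_hom A Q"
    using ring_hom_trans[OF U.const_ring_hom cl.homh] by (simp add: comp_def)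
  then show ?thesis
    using cl.S.is_cring is_cring
    by (simp add: ring_hom_cring_def ring_hom_cring_axioms_def cyc_const_def[abs_def])
qed

sublocale K: ring_hom_cring A Q K by (rule K_hom)

lemma X_closed [simp]: "X \<in> carrier Q"
  by (simp add: cyc_x_def)

lemma X_pow_class: "X [^]\<^bsub>Q\<^esub> i = poly_class A (cyc_modulus A n) (monom (UP A) \<one> i)"
  using U.monom_pow[of \<one> 1 i] by (simp add: cyc_x_def cl.hom_pow[symmetric] del: cl.hom_pow)

lemma class_monom:
  "a \<in> carrier A \<Longrightarrow> poly_class A (cyc_modulus A n) (monom (UP A) a i) = K a \<otimes>\<^bsub>Q\<^esub> X [^]\<^bsub>Q\<^esub> i"
  using U.monom_mult[of a \<one> 0 i] by (simp add: X_pow_class cyc_const_def)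

lemma X_pow_n: "X [^]\<^bsub>Q\<^esub> n = \<one>\<^bsub>Q\<^esub>"
proof -
  have "X [^]\<^bsub>Q\<^esub> n \<ominus>\<^bsub>Q\<^esub> \<one>\<^bsub>Q\<^esub> =
      poly_class A (cyc_modulus A n) (monom (UP A) \<one> n \<ominus>\<^bsub>UP A\<^esub> \<one>\<^bsub>UP A\<^esub>)"
    by (simp add: X_pow_class U.P.minus_eq cl.S.minus_eq)
  also have "\<dots> = poly_class A (cyc_modulus A n) (cyc_modulus A n)"
    by (simp only: cyc_modulus_def)
  also have "\<dots> = \<zero>\<^bsub>Q\<^esub>"
    using poly_class_modulus[OF is_cring cyc_modulus_closed] by (simp add: cyc_ring_def)
  finally show ?thesis by simp
qed

lemma X_pow_mod: "X [^]\<^bsub>Q\<^esub> i = X [^]\<^bsub>Q\<^esub> (i mod n)"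
proof -
  have "X [^]\<^bsub>Q\<^esub> i = X [^]\<^bsub>Q\<^esub> (n * (i div n) + i mod n)" by simp
  also have "\<dots> = (X [^]\<^bsub>Q\<^esub> n) [^]\<^bsub>Q\<^esub> (i div n) \<otimes>\<^bsub>Q\<^esub> X [^]\<^bsub>Q\<^esub> (i mod n)"
    by (simp only: cl.S.nat_pow_mult[symmetric] cl.S.nat_pow_pow X_closed)
  finally show ?thesis by (simp add: X_pow_n)
qed

section \<open>Words as unique representatives of residue classes\<close>

lemma wc_eq:
  assumes "c \<in> words"
  shows "wc c = (\<Oplus>\<^bsub>Q\<^esub>i\<in>{..<n}. K (c i) \<otimes>\<^bsub>Q\<^esub> X [^]\<^bsub>Q\<^esub> i)"
proof -
  have c: "c i \<in> carrier A" if "i < n" for i using assms that by auto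
  have "wc c = (\<Oplus>\<^bsub>Q\<^esub>i\<in>{..<n}. poly_class A (cyc_modulus A n) (monom (UP A) (c i) i))"
    unfolding word_class_def by (subst cl.hom_finsum) (auto simp: c comp_def)
  also have "\<dots> = (\<Oplus>\<^bsub>Q\<^esub>i\<in>{..<n}. K (c i) \<otimes>\<^bsub>Q\<^esub> X [^]\<^bsub>Q\<^esub> i)"
    by (rule cl.S.finsum_cong') (auto simp: class_monom c)
  finally show ?thesis .
qed

lemma wc_closed [simp]: "c \<in> words \<Longrightarrow> wc c \<in> carrier Q"
  unfolding word_class_def
  by (intro cl.hom_closed U.P.finsum_closed) (simp add: Pi_iff PiE_iff)

lemma wc_add:
  assumes "c \<in> words" "d \<in> words"
  shows "wc (\<lambda>i\<in>{..<n}. c i \<oplus> d i) = wc c \<oplus>\<^bsub>Q\<^esub> wc d"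
proof -
  have *: "c i \<in> carrier A" "d i \<in> carrier A" if "i < n" for i using assms that by auto
  then have "(\<lambda>i\<in>{..<n}. c i \<oplus> d i) \<in> words" by auto
  moreover have "(\<Oplus>\<^bsub>Q\<^esub>i\<in>{..<n}. K ((\<lambda>i\<in>{..<n}. c i \<oplus> d i) i) \<otimes>\<^bsub>Q\<^esub> X [^]\<^bsub>Q\<^esub> i) =
    (\<Oplus>\<^bsub>Q\<^esub>i\<in>{..<n}. K (c i) \<otimes>\<^bsub>Q\<^esub> X [^]\<^bsub>Q\<^esub> i \<oplus>\<^bsub>Q\<^esub> K (d i) \<otimes>\<^bsub>Q\<^esub> X [^]\<^bsub>Q\<^esub> i)"
    by (rule cl.S.finsum_cong') (auto simp: * cl.S.l_distr)
  ultimately show ?thesis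
    using assms by (simp add: wc_eq) (subst cl.S.finsum_addf, auto simp: *)
qed

lemma wc_smult:
  assumes "a \<in> carrier A" "c \<in> words"
  shows "wc (\<lambda>i\<in>{..<n}. a \<otimes> c i) = K a \<otimes>\<^bsub>Q\<^esub> wc c"
proof -
  have *: "c i \<in> carrier A" if "i < n" for i using assms that by auto
  then have "(\<lambda>i\<in>{..<n}. a \<otimes> c i) \<in> words" using assms by auto
  moreover have "(\<Oplus>\<^bsub>Q\<^esub>i\<in>{..<n}. K ((\<lambda>i\<in>{..<n}. a \<otimes> c i) i) \<otimes>\<^bsub>Q\<^esub> X [^]\<^bsub>Q\<^esub> i) =
    (\<Oplus>\<^bsub>Q\<^esub>i\<in>{..<n}. K a \<otimes>\<^bsub>Q\<^esub> (K (c i) \<otimes>\<^bsub>Q\<^esub> X [^]\<^bsub>Q\<^esub> i))"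
    using assms by (intro cl.S.finsum_cong') (auto simp: * cl.S.m_assoc)
  ultimately show ?thesis
    using assms by (simp add: wc_eq) (subst cl.S.finsum_rdistr, auto simp: *)
qed

lemma wc_single:
  assumes "a \<in> carrier A" "i < n"
  shows "wc (\<lambda>j\<in>{..<n}. if j = i then a else \<zero>) = K a \<otimes>\<^bsub>Q\<^esub> X [^]\<^bsub>Q\<^esub> i"
proof -
  have "(\<lambda>j\<in>{..<n}. if j = i then a else \<zero>) \<in> words" using assms by auto
  moreover have "(\<Oplus>\<^bsub>Q\<^esub>j\<in>{..<n}. K ((\<lambda>j\<in>{..<n}. if j = i then a else \<zero>) j) \<otimes>\<^bsub>Q\<^esub> X [^]\<^bsub>Q\<^esub> j) =
    (\<Oplus>\<^bsub>Q\<^esub>j\<in>{..<n}. if i = j then K a \<otimes>\<^bsub>Q\<^esub> X [^]\<^bsub>Q\<^esub> j else \<zero>\<^bsub>Q\<^esub>)"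
    using assms by (intro cl.S.finsum_cong') (auto)
  ultimately show ?thesis
    using assms by (simp add: wc_eq) (subst cl.S.finsum_singleton, auto)
qed

text \<open>Since x^n = 1, every monomial is the class of a word with at most one nonzero entry, and
  the classes of words are closed under addition.\<close>

lemma wc_surj: "wc ` words = carrier Q"
proof
  show "wc ` words \<subseteq> carrier Q" by (rule image_subsetI) (rule wc_closed)
  show "carrier Q \<subseteq> wc ` words"
  proof
    fix G assume "G \<in> carrier Q"
    then obtain p where p: "p \<in> carrier (UP A)" "G = poly_class A (cyc_modulus A n) p"
      using poly_class_surj[OF is_cring cyc_modulus_closed] unfolding cyc_ring_def by blast
    define c where "c = coeff (UP A) p"
    have c: "c i \<in> carrier A" for i using p by (simp add: c_def)
    have G: "G = (\<Oplus>\<^bsub>Q\<^esub>i\<in>{..deg A p}. K (c i) \<otimes>\<^bsub>Q\<^esub> X [^]\<^bsub>Q\<^esub> i)"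
      unfolding p(2) by (subst U.up_repr[OF p(1), symmetric], subst cl.hom_finsum)
        (auto simp: c class_monom comp_def c_def[symmetric])
    \<comment> \<open>Generalised from the exponents up to the degree to any finite set of
      exponents, so that one monomial can be added at a time.\<close>
    have fin: "(\<Oplus>\<^bsub>Q\<^esub>i\<in>I. K (c i) \<otimes>\<^bsub>Q\<^esub> X [^]\<^bsub>Q\<^esub> i) \<in> wc ` words" if "finite I" for I
      using that
    proof (induction I)
      case empty
      have "wc (\<lambda>j\<in>{..<n}. \<zero>) = \<zero>\<^bsub>Q\<^esub>"
        using wc_single[of \<zero> 0] n_pos by (simp cong: if_cong)
      then show ?case unfolding cl.S.finsum_empty by (rule image_eqI[of _ wc, OF sym]) simp
    next
      case (insert i I)
      then obtain d where d: "d \<in> words" "(\<Oplus>\<^bsub>Q\<^esub>i\<in>I. K (c i) \<otimes>\<^bsub>Q\<^esub> X [^]\<^bsub>Q\<^esub> i) = wc d"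
        by (elim imageE)
      define u where "u = (\<lambda>j\<in>{..<n}. if j = i mod n then c i else \<zero>)"
      have u: "u \<in> words" using c by (auto simp: u_def)
      have "wc u = K (c i) \<otimes>\<^bsub>Q\<^esub> X [^]\<^bsub>Q\<^esub> i"
        unfolding u_def using c n_pos by (simp add: wc_single X_pow_mod[of i])
      then have "(\<Oplus>\<^bsub>Q\<^esub>i\<in>insert i I. K (c i) \<otimes>\<^bsub>Q\<^esub> X [^]\<^bsub>Q\<^esub> i) = wc (\<lambda>j\<in>{..<n}. u j \<oplus> d j)"
        using insert d u c by (simp add: wc_add cl.S.finsum_insert)
      moreover have "(\<lambda>j\<in>{..<n}. u j \<oplus> d j) \<in> words" using u d by (simp add: Pi_iff PiE_iff)
      ultimately show ?case by (rule image_eqI)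
    qed
    then show "G \<in> wc ` words" unfolding G by simp
  qed
qed

text \<open>The polynomial p of the word is a multiple q (x^n - 1) with no coefficients from n
  onwards. This forces the coefficients of q to be n-periodic; as they vanish eventually, q = 0.
  Zero divisors in \<open>A\<close> do not disturb the argument.\<close>

lemma wc_eq_zeroD:
  assumes c: "c \<in> words" and z: "wc c = \<zero>\<^bsub>Q\<^esub>" and i: "i < n"
  shows "c i = \<zero>"
proof -
  have cc: "c j \<in> carrier A" if "j < n" for j using c that by auto
  define p where "p = (\<Oplus>\<^bsub>UP A\<^esub>i\<in>{..<n}. monom (UP A) (c i) i)"
  have p: "p \<in> carrier (UP A)" unfolding p_def by (rule U.P.finsum_closed) (auto simp: cc)
  have coeffp: "coeff (UP A) p k = (if k < n then c k else \<zero>)" for k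
  proof -
    have "coeff (UP A) p k = (\<Oplus>i\<in>{..<n}. coeff (UP A) (monom (UP A) (c i) i) k)"
      unfolding p_def by (subst U.coeff_finsum) (auto simp: cc)
    also have "\<dots> = (\<Oplus>i\<in>{..<n}. if k = i then c i else \<zero>)"
      by (rule finsum_cong') (auto simp: cc)
    also have "\<dots> = (if k < n then c k else \<zero>)"
    proof (cases "k < n")
      case True
      then show ?thesis by (subst finsum_singleton) (auto simp: cc)
    next
      case False
      then have "(\<Oplus>i\<in>{..<n}. if k = i then c i else \<zero>) = (\<Oplus>i\<in>{..<n}. \<zero>)"
        by (intro finsum_cong') auto
      then show ?thesis using False by simp
    qed
    finally show ?thesis .
  qed
  obtain q where q: "q \<in> carrier (UP A)" "p = q \<otimes>\<^bsub>UP A\<^esub> cyc_modulus A n"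
    using poly_class_eq_zeroD[OF is_cring cyc_modulus_closed p] z
    by (auto simp: word_class_def p_def cyc_ring_def)
  have qp: "p = monom (UP A) \<one> n \<otimes>\<^bsub>UP A\<^esub> q \<ominus>\<^bsub>UP A\<^esub> q"
    unfolding q(2) cyc_modulus_def using q(1)
    by (simp add: U.P.minus_eq U.P.r_distr U.P.r_minus U.P.m_comm)
  \<comment> \<open>Compare the coefficients of x^(k + n) in p = x^n q - q; the left side
    contributes zero because k + n is at least n.\<close>
  have step: "coeff (UP A) q k = coeff (UP A) q (k + n)" for k
  proof -
    have "coeff (UP A) p (k + n) = coeff (UP A) q k \<ominus> coeff (UP A) q (k + n)"
      unfolding qp using q(1) by (simp add: U.coeff_monom_mult U.coeff_closed del: U.coeff_mult)
    then have "coeff (UP A) q k \<ominus> coeff (UP A) q (k + n) = \<zero>" using coeffp[of "k + n"] by simp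
    then show ?thesis using q(1) by (simp add: U.coeff_closed)
  qed
  have "coeff (UP A) q k = coeff (UP A) q (k + m * n)" for k m
  proof (induction m)
    case (Suc m)
    then show ?case using step[of "k + m * n"] by (simp add: ac_simps)
  qed simp
  \<comment> \<open>Since n is positive, deg q + 1 periods lead beyond the degree of q.\<close>
  moreover have "coeff (UP A) q (k + Suc (deg A q) * n) = \<zero>" for k
  proof (rule U.deg_aboveD[OF _ q(1)])
    have "Suc (deg A q) * 1 \<le> Suc (deg A q) * n" using n_pos by (intro mult_le_mono) auto
    then show "deg A q < k + Suc (deg A q) * n" by simp
  qed
  ultimately have "coeff (UP A) q k = \<zero>" for k by metis
  then have "q = \<zero>\<^bsub>UP A\<^esub>" using q(1) by (intro U.up_eqI) auto
  then have "p = \<zero>\<^bsub>UP A\<^esub>" using q(2) cyc_modulus_closed by simp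
  then show ?thesis using coeffp[of i] i by simp
qed

lemma wc_inj: "inj_on wc words"
proof (rule inj_onI)
  fix c d assume cd: "c \<in> words" "d \<in> words" "wc c = wc d"
  have *: "c i \<in> carrier A" "d i \<in> carrier A" if "i < n" for i using cd that by auto
  \<comment> \<open>Negation is written as scaling by -1 so that \<open>wc_smult\<close> applies to
    it.\<close>
  define m where "m = (\<lambda>i\<in>{..<n}. \<ominus> \<one> \<otimes> d i)"
  have m: "m \<in> words" using cd by (auto simp: m_def)
  have "wc m = K (\<ominus> \<one>) \<otimes>\<^bsub>Q\<^esub> wc d" unfolding m_def using cd by (intro wc_smult) auto
  then have "wc (\<lambda>i\<in>{..<n}. c i \<oplus> m i) = \<zero>\<^bsub>Q\<^esub>"
    using cd m by (simp add: wc_add cl.S.l_minus cl.S.r_neg)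
  then have "(\<lambda>i\<in>{..<n}. c i \<oplus> m i) i = \<zero>" if "i < n" for i
    using wc_eq_zeroD[OF _ _ that, of "\<lambda>i\<in>{..<n}. c i \<oplus> m i"] * m by (simp add: Pi_iff PiE_iff)
  then have "c i \<oplus> \<ominus> d i = \<zero>" if "i < n" for i
    using that * by (simp add: m_def l_minus)
  then have "c i = d i" if "i < n" for i
    using that * by (metis minus_eq r_right_minus_eq)
  then show "c = d" by (intro PiE_ext[OF cd(1,2)]) simp
qed

text \<open>The cyclic shift moves entry i to position i + 1 modulo n, which is what multiplication
  by x does to exponents when x^n = 1.\<close>

lemma wc_shift:
  assumes "c \<in> words"
  shows "cyc_shift n c \<in> words" "wc (cyc_shift n c) = X \<otimes>\<^bsub>Q\<^esub> wc c"
proof -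
  have c: "c i \<in> carrier A" if "i < n" for i using assms that by auto
  show s: "cyc_shift n c \<in> words" using n_pos c by (simp add: cyc_shift_def PiE_iff)
  have s': "cyc_shift n c i \<in> carrier A" if "i < n" for i using s that by auto
  \<comment> \<open>A permutation of the positions, used to reindex the sum for the shifted
    word.\<close>
  define h where "h = (\<lambda>i. Suc i mod n)"
  have inj: "inj_on h {..<n}"
    unfolding h_def using n_pos by (auto simp: inj_on_def mod_Suc split: if_splits)
  have "h ` {..<n} \<subseteq> {..<n}" using n_pos by (auto simp: h_def)
  then have img: "h ` {..<n} = {..<n}" using endo_inj_surj[OF _ _ inj] by simp
  have sh: "cyc_shift n c (h i) = c i" if "i < n" for i
    using that n_pos by (auto simp: h_def cyc_shift_def mod_Suc)
  have "wc (cyc_shift n c) = (\<Oplus>\<^bsub>Q\<^esub>i\<in>h ` {..<n}. K (cyc_shift n c i) \<otimes>\<^bsub>Q\<^esub> X [^]\<^bsub>Q\<^esub> i)"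
    unfolding img using s by (rule wc_eq)
  also have "\<dots> = (\<Oplus>\<^bsub>Q\<^esub>i\<in>{..<n}. K (cyc_shift n c (h i)) \<otimes>\<^bsub>Q\<^esub> X [^]\<^bsub>Q\<^esub> h i)"
    using inj by (intro cl.S.finsum_reindex) (simp_all add: img Pi_iff s')
  also have "\<dots> = (\<Oplus>\<^bsub>Q\<^esub>i\<in>{..<n}. X \<otimes>\<^bsub>Q\<^esub> (K (c i) \<otimes>\<^bsub>Q\<^esub> X [^]\<^bsub>Q\<^esub> i))"
  proof (rule cl.S.finsum_cong')
    fix i assume "i \<in> {..<n}"
    then have i: "i < n" by simp
    have "X [^]\<^bsub>Q\<^esub> h i = X [^]\<^bsub>Q\<^esub> i \<otimes>\<^bsub>Q\<^esub> X"
      unfolding h_def X_pow_mod[symmetric] by simp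
    then show "K (cyc_shift n c (h i)) \<otimes>\<^bsub>Q\<^esub> X [^]\<^bsub>Q\<^esub> h i = X \<otimes>\<^bsub>Q\<^esub> (K (c i) \<otimes>\<^bsub>Q\<^esub> X [^]\<^bsub>Q\<^esub> i)"
      using c[OF i] by (simp add: sh[OF i] cl.S.m_ac)
  qed (simp_all add: Pi_iff c)
  also have "\<dots> = X \<otimes>\<^bsub>Q\<^esub> wc c"
    unfolding wc_eq[OF assms] by (rule cl.S.finsum_rdistr[symmetric]) (simp_all add: Pi_iff c)
  finally show "wc (cyc_shift n c) = X \<otimes>\<^bsub>Q\<^esub> wc c" .
qed

section \<open>Cyclic codes from ideals\<close>

text \<open>Closure under negation and the zero word come from scaling by -1 and by 0. The group
  structure on words is established only to identify additive inverses with scalings by -1.\<close>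

lemma submoduleI_words:
  assumes "D \<subseteq> words" "D \<noteq> {}"
    "\<And>c d. c \<in> D \<Longrightarrow> d \<in> D \<Longrightarrow> (\<lambda>i\<in>{..<n}. c i \<oplus> d i) \<in> D"
    "\<And>a c. a \<in> carrier A \<Longrightarrow> c \<in> D \<Longrightarrow> (\<lambda>i\<in>{..<n}. a \<otimes> c i) \<in> D"
  shows "submodule D A (word_module A n)"
proof -
  have mem: "c i \<in> carrier A" if "c \<in> words" "i < n" for c i using that by auto
  interpret W: group "add_monoid (word_module A n)"
  proof (rule groupI)
    fix x assume x: "x \<in> carrier (add_monoid (word_module A n))"
    then have x': "x \<in> words" by (simp add: word_module_def)
    then have xi: "x i \<in> carrier A" if "i < n" for i using that by (rule mem)
    show "\<one>\<^bsub>add_monoid (word_module A n)\<^esub> \<otimes>\<^bsub>add_monoid (word_module A n)\<^esub> x = x"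
      unfolding word_module_def using x' xi
      by (intro PiE_ext[of _ "{..<n}" "\<lambda>_. carrier A"]) (simp_all add: PiE_iff)
    show "\<exists>y\<in>carrier (add_monoid (word_module A n)).
        y \<otimes>\<^bsub>add_monoid (word_module A n)\<^esub> x = \<one>\<^bsub>add_monoid (word_module A n)\<^esub>"
      unfolding word_module_def using x' xi
      by (intro bexI[of _ "\<lambda>i\<in>{..<n}. \<ominus> x i"])
        (auto simp add: PiE_iff l_neg intro!: restrict_ext)
  qed (auto simp: word_module_def PiE_iff a_assoc fun_eq_iff)
  have neg: "inv\<^bsub>add_monoid (word_module A n)\<^esub> c = (\<lambda>i\<in>{..<n}. \<ominus> \<one> \<otimes> c i)" if "c \<in> D" for c
  proof -
    have "c \<in> words" using that assms(1) by blast
    then show ?thesis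
      using mem[of c] by (intro W.inv_equality)
        (auto simp: word_module_def PiE_iff l_minus l_neg intro!: restrict_ext)
  qed
  show ?thesis
  proof (intro submodule.intro subgroup.intro submodule_axioms.intro)
    obtain d where d: "d \<in> D" using assms(2) by blast
    then have "(\<lambda>i\<in>{..<n}. \<zero> \<otimes> d i) \<in> D" by (intro assms(4)) auto
    moreover have "(\<lambda>i\<in>{..<n}. \<zero> \<otimes> d i) = \<one>\<^bsub>add_monoid (word_module A n)\<^esub>"
      using mem[of d] d assms(1) by (auto simp: word_module_def intro!: restrict_ext)
    ultimately show "\<one>\<^bsub>add_monoid (word_module A n)\<^esub> \<in> D" by simp
  qed (use assms neg in \<open>auto simp: word_module_def\<close>)
qed

text \<open>On classes, scaling by a is multiplication by the constant \<open>K a\<close> and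
  shifting is multiplication by \<open>X\<close>, so an ideal is stable under both.\<close>

lemma cyclic_code_of_ideal:
  assumes "ideal J Q"
  shows "cyclic_code A n {y \<in> words. wc y \<in> J}"
proof -
  interpret J: ideal J Q by fact
  have mem: "c i \<in> carrier A" if "c \<in> words" "i < n" for c i using that by auto
  \<comment> \<open>Supplies a word whose class is zero, which makes the code nonempty.\<close>
  have "\<zero>\<^bsub>Q\<^esub> \<in> wc ` words" unfolding wc_surj by simp
  then obtain z where z: "z \<in> words" "wc z = \<zero>\<^bsub>Q\<^esub>" by (elim imageE) simp
  show ?thesis unfolding cyclic_code_def
  proof (intro conjI submoduleI_words image_subsetI)
    show "{y \<in> words. wc y \<in> J} \<noteq> {}"
      using z(1) J.zero_closed unfolding z(2)[symmetric] by blast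
  next
    fix c assume "c \<in> {y \<in> words. wc y \<in> J}"
    then have c: "c \<in> words" "wc c \<in> J" by blast+
    have "wc (cyc_shift n c) \<in> J" unfolding wc_shift(2)[OF c(1)] using c(2) X_closed by (rule J.I_l_closed)
    then show "cyc_shift n c \<in> {y \<in> words. wc y \<in> J}" using wc_shift(1)[OF c(1)] by blast
    {
      fix d assume "d \<in> {y \<in> words. wc y \<in> J}"
      then have d: "d \<in> words" "wc d \<in> J" by blast+
      have "wc (\<lambda>i\<in>{..<n}. c i \<oplus> d i) \<in> J"
        unfolding wc_add[OF c(1) d(1)] using c(2) d(2) by (rule J.a_closed)
      moreover have "(\<lambda>i\<in>{..<n}. c i \<oplus> d i) \<in> words" using mem[OF c(1)] mem[OF d(1)] by simp
      ultimately show "(\<lambda>i\<in>{..<n}. c i \<oplus> d i) \<in> {y \<in> words. wc y \<in> J}" by blast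
    }
    {
      fix a assume a: "a \<in> carrier A"
      have "wc (\<lambda>i\<in>{..<n}. a \<otimes> c i) \<in> J"
        unfolding wc_smult[OF a c(1)] using c(2) K.hom_closed[OF a] by (rule J.I_l_closed)
      moreover have "(\<lambda>i\<in>{..<n}. a \<otimes> c i) \<in> words" using mem[OF c(1)] a by simp
      ultimately show "(\<lambda>i\<in>{..<n}. a \<otimes> c i) \<in> {y \<in> words. wc y \<in> J}" by blast
    }
  qed blast
qed

section \<open>Homomorphisms out of A[x]/(x^n - 1)\<close>

text \<open>The condition s^n = 1 says that evaluation at s kills x^n - 1 and so descends to the
  quotient. It serves both for the substitution of x^(n-1) for x and for the extension of
  scalars.\<close>

lemma cyc_induced_eval:
  assumes "ring_hom_cring A S \<phi>" "s \<in> carrier S" "s [^]\<^bsub>S\<^esub> n = \<one>\<^bsub>S\<^esub>"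
  shows cyc_induced_eval_hom: "ring_hom_cring Q S (induced_eval A S \<phi> s)"
    and cyc_induced_eval_const: "a \<in> carrier A \<Longrightarrow> induced_eval A S \<phi> s (K a) = \<phi> a"
    and cyc_induced_eval_X: "induced_eval A S \<phi> s X = s"
proof -
  interpret ev: UP_univ_prop A S \<phi> "UP A" s "eval A S \<phi> s"
    using assms(1,2) U.UP_cring_axioms
    by (simp_all add: UP_univ_prop_def UP_pre_univ_prop_def UP_univ_prop_axioms_def)
  have "eval A S \<phi> s (monom (UP A) \<one> n \<ominus>\<^bsub>UP A\<^esub> \<one>\<^bsub>UP A\<^esub>) = \<zero>\<^bsub>S\<^esub>"
    using assms(3) by (simp add: U.P.minus_eq ev.Eval_monom ev.S.r_neg)
  then have z: "eval A S \<phi> s (cyc_modulus A n) = \<zero>\<^bsub>S\<^esub>" by (simp only: cyc_modulus_def)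
  show "ring_hom_cring Q S (induced_eval A S \<phi> s)"
    using induced_eval_hom[OF assms(1,2) cyc_modulus_closed z] by (simp add: cyc_ring_def)
  note iev = induced_eval_poly_class[OF assms(1,2) cyc_modulus_closed z]
  show "a \<in> carrier A \<Longrightarrow> induced_eval A S \<phi> s (K a) = \<phi> a"
    using assms by (simp add: cyc_const_def iev ev.eval_const)
  show "induced_eval A S \<phi> s X = s"
    using assms by (simp add: cyc_x_def iev ev.Eval_monom)
qed

text \<open>Every class is a sum of constants times powers of \<open>X\<close>, so a homomorphism is
  determined by its values on the constants and on \<open>X\<close>.\<close>

lemma cyc_hom_ext:
  assumes "ring_hom_cring Q S h" "ring_hom_cring Q S h'"
    "\<And>a. a \<in> carrier A \<Longrightarrow> h (K a) = h' (K a)" "h X = h' X" "Z \<in> carrier Q"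
  shows "h Z = h' Z"
proof -
  interpret h: ring_hom_cring Q S h by fact
  interpret h': ring_hom_cring Q S h' by fact
  obtain c where c: "c \<in> words" "Z = wc c" using assms(5) unfolding wc_surj[symmetric] by (elim imageE)
  have ci: "c i \<in> carrier A" if "i < n" for i using c that by auto
  have "h Z = (\<Oplus>\<^bsub>S\<^esub>i\<in>{..<n}. h (K (c i) \<otimes>\<^bsub>Q\<^esub> X [^]\<^bsub>Q\<^esub> i))"
    unfolding c(2) wc_eq[OF c(1)] by (subst h.hom_finsum) (simp_all add: Pi_iff ci comp_def)
  also have "\<dots> = (\<Oplus>\<^bsub>S\<^esub>i\<in>{..<n}. h' (K (c i) \<otimes>\<^bsub>Q\<^esub> X [^]\<^bsub>Q\<^esub> i))"
    using assms(3,4) by (intro h.S.finsum_cong') (simp_all add: Pi_iff ci)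
  also have "\<dots> = h' Z"
    unfolding c(2) wc_eq[OF c(1)] by (subst h'.hom_finsum) (simp_all add: Pi_iff ci comp_def)
  finally show ?thesis .
qed

lemma X_inv_pow_n: "(X [^]\<^bsub>Q\<^esub> (n - 1)) [^]\<^bsub>Q\<^esub> n = \<one>\<^bsub>Q\<^esub>"
proof -
  have "(X [^]\<^bsub>Q\<^esub> (n - 1)) [^]\<^bsub>Q\<^esub> n = (X [^]\<^bsub>Q\<^esub> n) [^]\<^bsub>Q\<^esub> (n - 1)"
    by (simp add: cl.S.nat_pow_pow mult.commute)
  then show ?thesis by (simp add: X_pow_n)
qed

sublocale inv: ring_hom_cring Q Q "cyc_inv A n"
  unfolding cyc_inv_def by (rule cyc_induced_eval_hom[OF K_hom _ X_inv_pow_n]) simp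

lemma cyc_inv_K [simp]: "a \<in> carrier A \<Longrightarrow> cyc_inv A n (K a) = K a"
  unfolding cyc_inv_def by (rule cyc_induced_eval_const[OF K_hom _ X_inv_pow_n]) simp_all

lemma cyc_inv_X: "cyc_inv A n X = X [^]\<^bsub>Q\<^esub> (n - 1)"
  unfolding cyc_inv_def by (rule cyc_induced_eval_X[OF K_hom _ X_inv_pow_n]) simp_all

section \<open>The inner product as a constant coefficient\<close>

text \<open>Choosing a word with \<open>inv_into\<close> is harmless: \<open>wc\<close> is a
  bijection from words to classes, so the chosen word is the only one of its class.\<close>

definition const_coeff where
  "const_coeff Z = inv_into words wc Z 0"

lemma const_coeff_wc: "c \<in> words \<Longrightarrow> const_coeff (wc c) = c 0"
  by (simp add: const_coeff_def inv_into_f_f[OF wc_inj])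

lemma wcE:
  assumes "Z \<in> carrier Q" obtains c where "c \<in> words" "Z = wc c" "\<forall>i<n. c i \<in> carrier A"
proof -
  obtain c where c: "c \<in> words" "Z = wc c" using assms unfolding wc_surj[symmetric] by (elim imageE)
  moreover have "\<forall>i<n. c i \<in> carrier A" using c by auto
  ultimately show ?thesis by (rule that)
qed

lemma const_coeff_closed [simp]: "Z \<in> carrier Q \<Longrightarrow> const_coeff Z \<in> carrier A"
  using n_pos by (elim wcE) (simp add: const_coeff_wc)

lemma const_coeff_add:
  assumes "Z \<in> carrier Q" "Z' \<in> carrier Q"
  shows "const_coeff (Z \<oplus>\<^bsub>Q\<^esub> Z') = const_coeff Z \<oplus> const_coeff Z'"
proof -
  obtain c where c: "c \<in> words" "Z = wc c" "\<forall>i<n. c i \<in> carrier A" using assms(1) by (rule wcE)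
  obtain d where d: "d \<in> words" "Z' = wc d" "\<forall>i<n. d i \<in> carrier A" using assms(2) by (rule wcE)
  have "(\<lambda>i\<in>{..<n}. c i \<oplus> d i) \<in> words" using c(3) d(3) by simp
  from const_coeff_wc[OF this] show ?thesis
    unfolding wc_add[OF c(1) d(1)] c(2) d(2) using n_pos c(1) d(1) by (simp add: const_coeff_wc)
qed

lemma const_coeff_smult:
  assumes "a \<in> carrier A" "Z \<in> carrier Q"
  shows "const_coeff (K a \<otimes>\<^bsub>Q\<^esub> Z) = a \<otimes> const_coeff Z"
proof -
  obtain c where c: "c \<in> words" "Z = wc c" "\<forall>i<n. c i \<in> carrier A" using assms(2) by (rule wcE)
  have "(\<lambda>i\<in>{..<n}. a \<otimes> c i) \<in> words" using c(3) assms(1) by simp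
  from const_coeff_wc[OF this] show ?thesis
    unfolding wc_smult[OF assms(1) c(1)] c(2) using n_pos c(1) by (simp add: const_coeff_wc)
qed

lemma const_coeff_X_pow: "const_coeff (X [^]\<^bsub>Q\<^esub> i) = (if n dvd i then \<one> else \<zero>)"
proof -
  have im: "i mod n < n" using n_pos by simp
  have "(\<lambda>j\<in>{..<n}. if j = i mod n then \<one> else \<zero>) \<in> words" by simp
  from const_coeff_wc[OF this] have "const_coeff (X [^]\<^bsub>Q\<^esub> (i mod n)) = (if 0 = i mod n then \<one> else \<zero>)"
    unfolding wc_single[OF one_closed im] using n_pos by simp
  then show ?thesis unfolding X_pow_mod[of i] by (auto simp: dvd_eq_mod_eq_0)
qed

lemma const_coeff_zero [simp]: "const_coeff \<zero>\<^bsub>Q\<^esub> = \<zero>"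
  using const_coeff_smult[of \<zero> "\<zero>\<^bsub>Q\<^esub>"] by simp

lemma const_coeff_finsum:
  "f \<in> I \<rightarrow> carrier Q \<Longrightarrow> const_coeff (\<Oplus>\<^bsub>Q\<^esub>i\<in>I. f i) = (\<Oplus>i\<in>I. const_coeff (f i))"
  by (induction I rule: infinite_finite_induct) (simp_all add: Pi_iff const_coeff_add)

text \<open>Expanding both factors, x^j times (x^(n-1))^k has constant coefficient 1 if j = k and 0
  otherwise, so only the diagonal terms survive.\<close>

lemma const_coeff_pairing:
  assumes "y \<in> words" "c \<in> words"
  shows "const_coeff (wc y \<otimes>\<^bsub>Q\<^esub> cyc_inv A n (wc c)) = (\<Oplus>j\<in>{..<n}. y j \<otimes> c j)"
proof -
  have mem: "y i \<in> carrier A" "c i \<in> carrier A" if "i < n" for i using assms that by auto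
  \<comment> \<open>The exponent equals n k + (j - k), and j - k lies strictly between -n and n. The
    integers avoid truncated subtraction.\<close>
  have dvd_iff: "n dvd j + (n - 1) * k \<longleftrightarrow> j = k" if "j < n" "k < n" for j k
  proof -
    have "int (j + (n - 1) * k) = int n * int k + (int j - int k)"
      using n_pos by (cases n) (simp_all add: algebra_simps)
    then have "n dvd j + (n - 1) * k \<longleftrightarrow> int n dvd int j - int k"
      by (metis dvd_add_right_iff dvd_triv_left of_nat_dvd_iff)
    also have "\<dots> \<longleftrightarrow> j = k" using that by (simp add: mod_eq_dvd_iff[symmetric])
    finally show ?thesis .
  qed
  have XX: "const_coeff (X [^]\<^bsub>Q\<^esub> j \<otimes>\<^bsub>Q\<^esub> (X [^]\<^bsub>Q\<^esub> (n - 1)) [^]\<^bsub>Q\<^esub> k) = (if j = k then \<one> else \<zero>)"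
    if "j < n" "k < n" for j k
    using dvd_iff[OF that] by (simp add: cl.S.nat_pow_pow cl.S.nat_pow_mult const_coeff_X_pow)
  have inv_c: "cyc_inv A n (wc c) =
      (\<Oplus>\<^bsub>Q\<^esub>k\<in>{..<n}. K (c k) \<otimes>\<^bsub>Q\<^esub> (X [^]\<^bsub>Q\<^esub> (n - 1)) [^]\<^bsub>Q\<^esub> k)"
    unfolding wc_eq[OF assms(2)]
    by (subst inv.hom_finsum, simp add: Pi_iff mem, rule cl.S.finsum_cong')
      (simp_all add: Pi_iff mem cyc_inv_X)
  have summand: "const_coeff (K (y j) \<otimes>\<^bsub>Q\<^esub> X [^]\<^bsub>Q\<^esub> j \<otimes>\<^bsub>Q\<^esub> cyc_inv A n (wc c)) = y j \<otimes> c j"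
    if j: "j < n" for j
  proof -
    have "X [^]\<^bsub>Q\<^esub> j \<otimes>\<^bsub>Q\<^esub> cyc_inv A n (wc c) =
      (\<Oplus>\<^bsub>Q\<^esub>k\<in>{..<n}. X [^]\<^bsub>Q\<^esub> j \<otimes>\<^bsub>Q\<^esub> (K (c k) \<otimes>\<^bsub>Q\<^esub> (X [^]\<^bsub>Q\<^esub> (n - 1)) [^]\<^bsub>Q\<^esub> k))"
      unfolding inv_c by (rule cl.S.finsum_rdistr) (simp_all add: Pi_iff mem)
    also have "\<dots> = (\<Oplus>\<^bsub>Q\<^esub>k\<in>{..<n}. K (c k) \<otimes>\<^bsub>Q\<^esub> (X [^]\<^bsub>Q\<^esub> j \<otimes>\<^bsub>Q\<^esub> (X [^]\<^bsub>Q\<^esub> (n - 1)) [^]\<^bsub>Q\<^esub> k))"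
      by (rule cl.S.finsum_cong') (simp_all add: Pi_iff mem cl.S.m_lcomm)
    also have "const_coeff \<dots> = (\<Oplus>k\<in>{..<n}. if j = k then c k else \<zero>)"
      by (subst const_coeff_finsum, simp add: Pi_iff mem, rule finsum_cong')
        (simp_all add: Pi_iff mem const_coeff_smult XX[OF j] del: One_nat_def)
    also have "\<dots> = c j" using j by (subst finsum_singleton) (auto simp: mem)
    finally show ?thesis using mem[OF j] assms by (simp add: cl.S.m_assoc const_coeff_smult)
  qed
  have "wc y \<otimes>\<^bsub>Q\<^esub> cyc_inv A n (wc c) =
      (\<Oplus>\<^bsub>Q\<^esub>j\<in>{..<n}. K (y j) \<otimes>\<^bsub>Q\<^esub> X [^]\<^bsub>Q\<^esub> j \<otimes>\<^bsub>Q\<^esub> cyc_inv A n (wc c))"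
    unfolding wc_eq[OF assms(1)] using assms(2)
    by (intro cl.S.finsum_ldistr) (simp_all add: Pi_iff mem)
  also have "const_coeff \<dots> = (\<Oplus>j\<in>{..<n}. y j \<otimes> c j)"
    using assms(2)
    by (subst const_coeff_finsum, simp add: Pi_iff mem, intro finsum_cong')
      (simp_all add: Pi_iff mem summand)
  finally show ?thesis .
qed

section \<open>Idempotent generators and the dual code\<close>

lemma genideal_singleton: "g \<in> carrier Q \<Longrightarrow> Idl\<^bsub>Q\<^esub> {g} = {Z \<otimes>\<^bsub>Q\<^esub> g |Z. Z \<in> carrier Q}"
  using cl.S.cgenideal_eq_genideal[of g] by (auto simp: cgenideal_def)

text \<open>If Z = W g then Z g = W g g = W g = Z. Membership in the ideal thus becomes an equation
  without a quantifier.\<close>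

lemma genideal_idempotent_iff:
  assumes "cyc_idempotent A n g"
  shows "Z \<in> Idl\<^bsub>Q\<^esub> {g} \<longleftrightarrow> Z \<in> carrier Q \<and> Z \<otimes>\<^bsub>Q\<^esub> g = Z"
proof -
  have g: "g \<in> carrier Q" "g \<otimes>\<^bsub>Q\<^esub> g = g" using assms by (auto simp: cyc_idempotent_def)
  show ?thesis
  proof
    assume "Z \<in> Idl\<^bsub>Q\<^esub> {g}"
    then obtain W where "W \<in> carrier Q" "Z = W \<otimes>\<^bsub>Q\<^esub> g" unfolding genideal_singleton[OF g(1)] by blast
    then show "Z \<in> carrier Q \<and> Z \<otimes>\<^bsub>Q\<^esub> g = Z" using g by (simp add: cl.S.m_assoc)
  next
    assume "Z \<in> carrier Q \<and> Z \<otimes>\<^bsub>Q\<^esub> g = Z"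
    then show "Z \<in> Idl\<^bsub>Q\<^esub> {g}" unfolding genideal_singleton[OF g(1)] by force
  qed
qed

text \<open>Each generator lies in the ideal of the other and is fixed by multiplication with it, so
  g = g h = h g = h.\<close>

lemma idempotent_generator_unique:
  assumes "idempotent_generator A n D g" "idempotent_generator A n D h"
  shows "g = h"
proof -
  have g: "cyc_idempotent A n g" "g \<in> carrier Q" and h: "cyc_idempotent A n h" "h \<in> carrier Q"
    and eq: "Idl\<^bsub>Q\<^esub> {g} = Idl\<^bsub>Q\<^esub> {h}"
    using assms by (auto simp: idempotent_generator_def code_generated_by_def cyc_idempotent_def)
  have "g \<otimes>\<^bsub>Q\<^esub> h = g"
    using cl.S.genideal_self'[OF g(2)] unfolding eq genideal_idempotent_iff[OF h(1)] by simp
  moreover have "h \<otimes>\<^bsub>Q\<^esub> g = h"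
    using cl.S.genideal_self'[OF h(2)] unfolding eq[symmetric] genideal_idempotent_iff[OF g(1)] by simp
  ultimately show ?thesis using g(2) h(2) cl.S.m_comm by metis
qed

text \<open>Pairing with the unit word at position i reads off entry i. Hence a class whose products
  with all inverted powers of \<open>X\<close> have zero constant coefficient is itself
  zero.\<close>

lemma pairing_unit:
  assumes "z \<in> words" "i < n"
  shows "const_coeff (wc z \<otimes>\<^bsub>Q\<^esub> cyc_inv A n (X [^]\<^bsub>Q\<^esub> i)) = z i"
proof -
  have z: "z j \<in> carrier A" if "j < n" for j using assms(1) that by auto
  define u where "u = (\<lambda>j\<in>{..<n}. if j = i then \<one> else \<zero>)"
  have u: "u \<in> words" by (simp add: u_def)
  have "wc u = X [^]\<^bsub>Q\<^esub> i" unfolding u_def wc_single[OF one_closed assms(2)] by simp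
  then have "const_coeff (wc z \<otimes>\<^bsub>Q\<^esub> cyc_inv A n (X [^]\<^bsub>Q\<^esub> i)) = (\<Oplus>j\<in>{..<n}. z j \<otimes> u j)"
    using const_coeff_pairing[OF assms(1) u] by simp
  also have "\<dots> = (\<Oplus>j\<in>{..<n}. if i = j then z j else \<zero>)"
    by (rule finsum_cong') (simp_all add: Pi_iff u_def z)
  also have "\<dots> = z i" using assms(2) by (subst finsum_singleton) (simp_all add: Pi_iff z)
  finally show ?thesis .
qed

lemma dual_code_iff:
  assumes "C \<subseteq> words" "g \<in> carrier Q" "wc ` C = Idl\<^bsub>Q\<^esub> {g}" "y \<in> words"
  shows "y \<in> dual_code A n C \<longleftrightarrow> wc y \<otimes>\<^bsub>Q\<^esub> cyc_inv A n g = \<zero>\<^bsub>Q\<^esub>"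
proof
  assume y: "y \<in> dual_code A n C"
  have "wc y \<otimes>\<^bsub>Q\<^esub> cyc_inv A n g \<in> carrier Q" using assms(2,4) by simp
  then obtain z where z: "z \<in> words" "wc y \<otimes>\<^bsub>Q\<^esub> cyc_inv A n g = wc z" by (rule wcE)
  have "z i = \<zero>" if i: "i < n" for i
  proof -
    \<comment> \<open>The shift x^i g is the class of a codeword c, to which y is orthogonal. Since
      inversion is multiplicative, entry i of y g* is the inner product of y with c.\<close>
    have "X [^]\<^bsub>Q\<^esub> i \<otimes>\<^bsub>Q\<^esub> g \<in> wc ` C"
      unfolding assms(3) genideal_singleton[OF assms(2)]
      by (intro CollectI exI[of _ "X [^]\<^bsub>Q\<^esub> i"]) simp
    then obtain c where c: "c \<in> C" "X [^]\<^bsub>Q\<^esub> i \<otimes>\<^bsub>Q\<^esub> g = wc c" by (elim imageE)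
    have cw: "c \<in> words" using c(1) assms(1) by (rule subsetD[rotated])
    have "z i = const_coeff (wc y \<otimes>\<^bsub>Q\<^esub> cyc_inv A n g \<otimes>\<^bsub>Q\<^esub> cyc_inv A n (X [^]\<^bsub>Q\<^esub> i))"
      unfolding z(2) by (rule pairing_unit[OF z(1) i, symmetric])
    also have "\<dots> = const_coeff (wc y \<otimes>\<^bsub>Q\<^esub> cyc_inv A n (wc c))"
      unfolding c(2)[symmetric] using assms(2,4) by (simp add: cl.S.m_ac)
    also have "\<dots> = \<zero>"
      unfolding const_coeff_pairing[OF assms(4) cw] using y c(1) by (simp add: dual_code_def)
    finally show ?thesis .
  qed
  then have "wc z = (\<Oplus>\<^bsub>Q\<^esub>i\<in>{..<n}. \<zero>\<^bsub>Q\<^esub>)"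
    unfolding wc_eq[OF z(1)] by (intro cl.S.finsum_cong') simp_all
  then show "wc y \<otimes>\<^bsub>Q\<^esub> cyc_inv A n g = \<zero>\<^bsub>Q\<^esub>" unfolding z(2) by simp
next
  assume y: "wc y \<otimes>\<^bsub>Q\<^esub> cyc_inv A n g = \<zero>\<^bsub>Q\<^esub>"
  have "(\<Oplus>j\<in>{..<n}. y j \<otimes> c j) = \<zero>" if c: "c \<in> C" for c
  proof -
    have cw: "c \<in> words" using c assms(1) by (rule subsetD[rotated])
    have "wc c \<in> Idl\<^bsub>Q\<^esub> {g}" unfolding assms(3)[symmetric] using c by (rule imageI)
    then obtain W where W: "W \<in> carrier Q" "wc c = W \<otimes>\<^bsub>Q\<^esub> g"
      unfolding genideal_singleton[OF assms(2)] by blast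
    \<comment> \<open>With c = W g the whole product y c* is a multiple of y g* = 0, so in
      particular its constant coefficient vanishes.\<close>
    have "wc y \<otimes>\<^bsub>Q\<^esub> cyc_inv A n (wc c) = cyc_inv A n W \<otimes>\<^bsub>Q\<^esub> (wc y \<otimes>\<^bsub>Q\<^esub> cyc_inv A n g)"
      unfolding W(2) using W(1) assms(2,4) by (simp add: cl.S.m_lcomm)
    then show ?thesis
      unfolding const_coeff_pairing[OF assms(4) cw, symmetric] y using W(1) by simp
  qed
  then show "y \<in> dual_code A n C" using assms(4) by (simp add: dual_code_def word_module_def)
qed

text \<open>The dual is the annihilator of the idempotent s = g*, and the annihilator of an
  idempotent s is generated by the idempotent 1 - s. Uniqueness of idempotent generators turns this
  into an equivalence.\<close>

theorem dual_idempotent_generator: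
  assumes "C \<subseteq> words" "code_generated_by A n C {g}" "cyc_idempotent A n g"
  shows "idempotent_generator A n (dual_code A n C) h \<longleftrightarrow> h = \<one>\<^bsub>Q\<^esub> \<ominus>\<^bsub>Q\<^esub> cyc_inv A n g"
proof -
  have g: "g \<in> carrier Q" "g \<otimes>\<^bsub>Q\<^esub> g = g" using assms(3) by (auto simp: cyc_idempotent_def)
  have C: "wc ` C = Idl\<^bsub>Q\<^esub> {g}" using assms(2) by (simp add: code_generated_by_def)
  define s where "s = cyc_inv A n g"
  have s: "s \<in> carrier Q" "s \<otimes>\<^bsub>Q\<^esub> s = s"
    using g inv.hom_mult[of g g] by (simp_all add: s_def)
  define h0 where "h0 = \<one>\<^bsub>Q\<^esub> \<ominus>\<^bsub>Q\<^esub> s"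
  have h0c: "h0 \<in> carrier Q" using s by (simp add: h0_def)
  have mult_h0: "Z \<otimes>\<^bsub>Q\<^esub> h0 = Z \<ominus>\<^bsub>Q\<^esub> Z \<otimes>\<^bsub>Q\<^esub> s" if "Z \<in> carrier Q" for Z
    using that s(1) by (simp add: h0_def cl.S.minus_eq cl.S.r_distr cl.S.r_minus)
  have "h0 \<otimes>\<^bsub>Q\<^esub> s = \<zero>\<^bsub>Q\<^esub>"
    using s by (simp add: h0_def cl.S.minus_eq cl.S.l_distr cl.S.l_minus cl.S.r_neg)
  then have idem: "cyc_idempotent A n h0"
    using h0c by (simp add: cyc_idempotent_def mult_h0 cl.S.minus_eq)
  \<comment> \<open>Membership means Z (1 - s) = Z, that is Z - Z s = Z; cancelling Z leaves Z s =
    0.\<close>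
  have J: "Z \<in> Idl\<^bsub>Q\<^esub> {h0} \<longleftrightarrow> Z \<in> carrier Q \<and> Z \<otimes>\<^bsub>Q\<^esub> s = \<zero>\<^bsub>Q\<^esub>" for Z
  proof (cases "Z \<in> carrier Q")
    case True
    then have Zs: "Z \<otimes>\<^bsub>Q\<^esub> s \<in> carrier Q" using s(1) by simp
    have "Z \<ominus>\<^bsub>Q\<^esub> (Z \<ominus>\<^bsub>Q\<^esub> Z \<otimes>\<^bsub>Q\<^esub> s) = Z \<otimes>\<^bsub>Q\<^esub> s"
      using True Zs by (simp add: cl.S.minus_eq cl.S.minus_add cl.S.r_neg2)
    then have "Z \<otimes>\<^bsub>Q\<^esub> s = \<zero>\<^bsub>Q\<^esub>" if "Z \<ominus>\<^bsub>Q\<^esub> Z \<otimes>\<^bsub>Q\<^esub> s = Z"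
      unfolding that using True by (simp add: cl.S.minus_eq cl.S.r_neg)
    moreover have "Z \<ominus>\<^bsub>Q\<^esub> Z \<otimes>\<^bsub>Q\<^esub> s = Z" if "Z \<otimes>\<^bsub>Q\<^esub> s = \<zero>\<^bsub>Q\<^esub>"
      unfolding that using True by (simp add: cl.S.minus_eq)
    ultimately have "Z \<ominus>\<^bsub>Q\<^esub> Z \<otimes>\<^bsub>Q\<^esub> s = Z \<longleftrightarrow> Z \<otimes>\<^bsub>Q\<^esub> s = \<zero>\<^bsub>Q\<^esub>" by (rule iffI)
    then show ?thesis using True by (simp add: genideal_idempotent_iff[OF idem] mult_h0)
  qed (simp add: genideal_idempotent_iff[OF idem])
  have dual: "dual_code A n C = {y \<in> words. wc y \<in> Idl\<^bsub>Q\<^esub> {h0}}"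
  proof (rule Set.set_eqI)
    fix y
    show "y \<in> dual_code A n C \<longleftrightarrow> y \<in> {y \<in> words. wc y \<in> Idl\<^bsub>Q\<^esub> {h0}}"
    proof (cases "y \<in> words")
      case True
      then show ?thesis
        using dual_code_iff[OF assms(1) g(1) C True] wc_closed[OF True] by (simp add: J s_def)
    qed (simp add: dual_code_def word_module_def)
  qed
  have I: "ideal (Idl\<^bsub>Q\<^esub> {h0}) Q" using h0c by (intro cl.S.genideal_ideal) simp
  have "wc ` {y \<in> words. wc y \<in> Idl\<^bsub>Q\<^esub> {h0}} = Idl\<^bsub>Q\<^esub> {h0}"
  proof (intro subset_antisym subsetI)
    fix Z assume Z: "Z \<in> Idl\<^bsub>Q\<^esub> {h0}"
    then have "Z \<in> carrier Q" using J by blast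
    then obtain y where "y \<in> words" "Z = wc y" by (rule wcE)
    then show "Z \<in> wc ` {y \<in> words. wc y \<in> Idl\<^bsub>Q\<^esub> {h0}}" using Z by (intro image_eqI[of _ wc y]) simp_all
  qed blast
  then have "idempotent_generator A n (dual_code A n C) h0"
    using cyclic_code_of_ideal[OF I] idem
    by (simp add: idempotent_generator_def code_generated_by_def dual)
  then show ?thesis using idempotent_generator_unique unfolding h0_def s_def by metis
qed

end

section \<open>Orthogonal idempotents\<close>

text \<open>Kept abstract because the same calculus is needed in \<open>R_full F r\<close>, to build
  the subring, and in the ring of cyclic codes over \<open>R_sub F r\<close>, to handle the
  generators.\<close>

locale orthogonal_idempotents = cring A for A (structure) +
  fixes a1 a2 a3
  assumes idem_closed [simp]: "a1 \<in> carrier A" "a2 \<in> carrier A" "a3 \<in> carrier A"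
    and idem: "a1 \<otimes> a1 = a1" "a2 \<otimes> a2 = a2" "a3 \<otimes> a3 = a3"
    and orth: "a1 \<otimes> a2 = \<zero>" "a1 \<otimes> a3 = \<zero>" "a2 \<otimes> a3 = \<zero>"
    and sum_one: "a1 \<oplus> a2 \<oplus> a3 = \<one>"
begin

definition comb where "comb x y z = a1 \<otimes> x \<oplus> a2 \<otimes> y \<oplus> a3 \<otimes> z"

lemma comb_closed [simp]:
  "x \<in> carrier A \<Longrightarrow> y \<in> carrier A \<Longrightarrow> z \<in> carrier A \<Longrightarrow> comb x y z \<in> carrier A"
  by (simp add: comb_def)

text \<open>Multiplying by one idempotent kills the other two summands, so it projects onto one
  component.\<close>

lemma comb_absorb:
  assumes "x \<in> carrier A" "y \<in> carrier A" "z \<in> carrier A"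
  shows "a1 \<otimes> comb x y z = a1 \<otimes> x" "a2 \<otimes> comb x y z = a2 \<otimes> y" "a3 \<otimes> comb x y z = a3 \<otimes> z"
  using assms orth m_comm[of a2 a1] m_comm[of a3 a1] m_comm[of a3 a2]
  by (simp_all add: comb_def r_distr m_assoc[symmetric] idem)

lemma comb_const: "x \<in> carrier A \<Longrightarrow> comb x x x = x"
  using sum_one by (simp add: comb_def l_distr[symmetric])

lemma comb_mult:
  assumes "x \<in> carrier A" "y \<in> carrier A" "z \<in> carrier A"
    "x' \<in> carrier A" "y' \<in> carrier A" "z' \<in> carrier A"
  shows "comb x y z \<otimes> comb x' y' z' = comb (x \<otimes> x') (y \<otimes> y') (z \<otimes> z')"
proof -
  have "comb x y z \<otimes> comb x' y' z' =
      a1 \<otimes> x \<otimes> comb x' y' z' \<oplus> a2 \<otimes> y \<otimes> comb x' y' z' \<oplus> a3 \<otimes> z \<otimes> comb x' y' z'"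
    using assms by (simp add: comb_def[of x y z] l_distr)
  also have "\<dots> = x \<otimes> (a1 \<otimes> comb x' y' z') \<oplus> y \<otimes> (a2 \<otimes> comb x' y' z') \<oplus> z \<otimes> (a3 \<otimes> comb x' y' z')"
    using assms by (simp add: m_ac)
  also have "\<dots> = comb (x \<otimes> x') (y \<otimes> y') (z \<otimes> z')"
    using assms by (simp only: comb_absorb) (simp add: comb_def m_ac)
  finally show ?thesis .
qed

lemma comb_add:
  assumes "x \<in> carrier A" "y \<in> carrier A" "z \<in> carrier A"
    "x' \<in> carrier A" "y' \<in> carrier A" "z' \<in> carrier A"
  shows "comb x y z \<oplus> comb x' y' z' = comb (x \<oplus> x') (y \<oplus> y') (z \<oplus> z')"
  using assms by (simp add: comb_def r_distr a_ac)

lemma comb_minus: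
  assumes "x \<in> carrier A" "y \<in> carrier A" "z \<in> carrier A"
  shows "\<ominus> comb x y z = comb (\<ominus> x) (\<ominus> y) (\<ominus> z)"
  using assms by (simp add: comb_def r_minus minus_add a_ac)

text \<open>The combination is the sum of the three generators; conversely, multiplying it by
  \<open>a1\<close>, \<open>a2\<close>, \<open>a3\<close> recovers each of them.\<close>

lemma genideal_comb:
  assumes "x \<in> carrier A" "y \<in> carrier A" "z \<in> carrier A"
  shows "Idl {a1 \<otimes> x, a2 \<otimes> y, a3 \<otimes> z} = Idl {comb x y z}"
proof
  interpret I: ideal "Idl {a1 \<otimes> x, a2 \<otimes> y, a3 \<otimes> z}" A
    using assms by (intro genideal_ideal) simp
  interpret J: ideal "Idl {comb x y z}" A
    using assms by (intro genideal_ideal) simp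
  have "{a1 \<otimes> x, a2 \<otimes> y, a3 \<otimes> z} \<subseteq> Idl {a1 \<otimes> x, a2 \<otimes> y, a3 \<otimes> z}"
    using assms by (intro genideal_self) simp
  then have "comb x y z \<in> Idl {a1 \<otimes> x, a2 \<otimes> y, a3 \<otimes> z}"
    unfolding comb_def by (intro I.a_closed) simp_all
  then show "Idl {comb x y z} \<subseteq> Idl {a1 \<otimes> x, a2 \<otimes> y, a3 \<otimes> z}"
    by (intro genideal_minimal I.ideal_axioms) simp
  have "comb x y z \<in> Idl {comb x y z}" using assms by (intro genideal_self') simp
  then have "e \<otimes> comb x y z \<in> Idl {comb x y z}" if "e \<in> carrier A" for e
    using that by (rule J.I_l_closed)
  from this[of a1] this[of a2] this[of a3]
  have "a1 \<otimes> x \<in> Idl {comb x y z}" "a2 \<otimes> y \<in> Idl {comb x y z}" "a3 \<otimes> z \<in> Idl {comb x y z}"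
    using assms by (simp_all only: comb_absorb idem_closed simp_thms)
  then show "Idl {a1 \<otimes> x, a2 \<otimes> y, a3 \<otimes> z} \<subseteq> Idl {comb x y z}"
    by (intro genideal_minimal J.ideal_axioms) simp
qed

end

text \<open>The hypothesis a w = a orders the idempotents as a chain 0, a, w, 1; the successive
  differences of such a chain are orthogonal and sum to 1.\<close>

lemma (in cring) orthogonal_idempotents_chain:
  assumes "a \<in> carrier R" "w \<in> carrier R" "a \<otimes> a = a" "w \<otimes> w = w" "a \<otimes> w = a"
  shows "orthogonal_idempotents R a (w \<ominus> a) (\<one> \<ominus> w)"
proof
  have c: "w \<otimes> a = a" using assms m_comm by simp
  show "(w \<ominus> a) \<otimes> (w \<ominus> a) = w \<ominus> a" "(\<one> \<ominus> w) \<otimes> (\<one> \<ominus> w) = \<one> \<ominus> w"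
    "a \<otimes> (w \<ominus> a) = \<zero>" "a \<otimes> (\<one> \<ominus> w) = \<zero>" "(w \<ominus> a) \<otimes> (\<one> \<ominus> w) = \<zero>"
    using assms c
    by (simp_all add: minus_eq l_distr r_distr l_minus r_minus l_neg r_neg r_neg1 r_neg2 a_ac minus_add)
  have "a \<oplus> (w \<ominus> a) = w" "w \<oplus> (\<one> \<ominus> w) = \<one>"
    using assms a_lcomm[of a w "\<ominus> a"] a_lcomm[of w \<one> "\<ominus> w"] by (simp_all add: minus_eq r_neg)
  then show "a \<oplus> (w \<ominus> a) \<oplus> (\<one> \<ominus> w) = \<one>" by simp
qed (use assms in simp_all)

lemma (in ring_hom_cring) orthogonal_idempotents_image:
  assumes "orthogonal_idempotents R a1 a2 a3"
  shows "orthogonal_idempotents S (h a1) (h a2) (h a3)"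
proof -
  interpret orthogonal_idempotents R a1 a2 a3 by fact
  show ?thesis
    by unfold_locales (simp_all add: hom_mult[symmetric] hom_add[symmetric] idem orth sum_one
        del: hom_mult hom_add)
qed

text \<open>The additive order of 1 divides the order of the ring, and also r; as these are coprime,
  it is 1.\<close>

lemma (in ring) one_eq_zero_of_coprime_order:
  assumes "finite (carrier R)" "coprime r (order R)" "[r] \<cdot> \<one> = \<zero>"
  shows "\<one> = \<zero>"
proof -
  have "[order R] \<cdot> \<one> = \<zero>"
    using add.pow_order_eq_1[OF one_closed] by (simp add: order_def)
  then have "add.ord \<one> dvd order R" by (simp add: add.pow_eq_id)
  moreover have "add.ord \<one> dvd r" using assms(3) by (simp add: add.pow_eq_id)
  ultimately have "add.ord \<one> dvd 1" using assms(2) by (metis coprime_common_divisor)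
  then show ?thesis using add.pow_eq_id[OF one_closed, of 1] by simp
qed

section \<open>The ring \<open>e\<^sub>1F \<oplus> e\<^sub>2F \<oplus> e\<^sub>3F\<close>\<close>

text \<open>That r is a unit gives meaning to the factor 1/r in \<open>e1\<close> and
  \<open>e2\<close>.\<close>

locale split_ring = F?: cring F for F (structure) +
  fixes r :: nat
  assumes r_pos: "0 < r" and r_unit: "[r] \<cdot> \<one> \<in> Units F"
begin

abbreviation S where "S \<equiv> R_full F r"
abbreviation \<kappa> where "\<kappa> \<equiv> R_const F r"
abbreviation V where "V \<equiv> R_v F r"

sublocale UF: UP_cring F "UP F"
  by (simp_all add: UP_cring_def is_cring)

lemma R_modulus_closed: "R_modulus F r \<in> carrier (UP F)"
  by (simp add: R_modulus_def)

sublocale Rcl: ring_hom_cring "UP F" S "poly_class F (R_modulus F r)"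
  using poly_class_hom[OF is_cring R_modulus_closed] by (simp add: R_full_def)

lemma R_const_hom: "ring_hom_cring F S \<kappa>"
proof -
  have "(\<lambda>a. poly_class F (R_modulus F r) (monom (UP F) a 0)) \<in> ring_hom F S"
    using ring_hom_trans[OF UF.const_ring_hom Rcl.homh] by (simp add: comp_def)
  then show ?thesis
    using Rcl.S.is_cring is_cring
    by (simp add: ring_hom_cring_def ring_hom_cring_axioms_def R_const_def[abs_def])
qed

sublocale \<kappa>: ring_hom_cring F S \<kappa> by (rule R_const_hom)

lemma V_closed [simp]: "V \<in> carrier S"
  by (simp add: R_v_def)

lemma V_pow_Suc_r: "V [^]\<^bsub>S\<^esub> Suc r = V"
proof -
  have pow: "V [^]\<^bsub>S\<^esub> i = poly_class F (R_modulus F r) (monom (UP F) \<one> i)" for i :: nat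
    using UF.monom_pow[of \<one> 1 i] by (simp add: R_v_def Rcl.hom_pow[symmetric] del: Rcl.hom_pow)
  have "V [^]\<^bsub>S\<^esub> (r + 1) \<ominus>\<^bsub>S\<^esub> V [^]\<^bsub>S\<^esub> (1::nat) = poly_class F (R_modulus F r)
      (monom (UP F) \<one> (r + 1) \<ominus>\<^bsub>UP F\<^esub> monom (UP F) \<one> 1)"
    unfolding pow by (simp add: UF.P.minus_eq Rcl.S.minus_eq)
  also have "\<dots> = poly_class F (R_modulus F r) (R_modulus F r)"
    by (simp only: R_modulus_def)
  also have "\<dots> = \<zero>\<^bsub>S\<^esub>"
    using poly_class_modulus[OF is_cring R_modulus_closed] by (simp add: R_full_def)
  finally show ?thesis by simp
qed

section \<open>Orthogonality of \<open>e1\<close>, \<open>e2\<close>, \<open>e3\<close>\<close>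

abbreviation \<rho> where "\<rho> \<equiv> inv ([r] \<cdot> \<one>)"

definition T where "T = (\<Oplus>\<^bsub>S\<^esub>j\<in>{1..r}. V [^]\<^bsub>S\<^esub> j)"

lemma T_closed [simp]: "T \<in> carrier S"
  unfolding T_def by (intro Rcl.S.finsum_closed) simp

lemma \<rho>_closed [simp]: "\<rho> \<in> carrier F" using r_unit by simp

text \<open>Multiplication by v moves the exponents 1, ..., r to 2, ..., r + 1, and v^(r+1) = v
  closes the cycle.\<close>

lemma V_mult_T: "V \<otimes>\<^bsub>S\<^esub> T = T"
proof -
  \<comment> \<open>Both sides equal v + ... + v^(m+1), whatever m is. The relation on v enters only
    afterwards, at m = r, where v cancels.\<close>
  have "V \<oplus>\<^bsub>S\<^esub> V \<otimes>\<^bsub>S\<^esub> (\<Oplus>\<^bsub>S\<^esub>j\<in>{1..m}. V [^]\<^bsub>S\<^esub> j) = V [^]\<^bsub>S\<^esub> Suc m \<oplus>\<^bsub>S\<^esub> (\<Oplus>\<^bsub>S\<^esub>j\<in>{1..m}. V [^]\<^bsub>S\<^esub> j)"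
    for m :: nat
  proof (induction m)
    case (Suc m)
    let ?s = "\<Oplus>\<^bsub>S\<^esub>j\<in>{1..m}. V [^]\<^bsub>S\<^esub> j"
    have s: "?s \<in> carrier S" by (intro Rcl.S.finsum_closed) simp
    have ins: "(\<Oplus>\<^bsub>S\<^esub>j\<in>{1..Suc m}. V [^]\<^bsub>S\<^esub> j) = V [^]\<^bsub>S\<^esub> Suc m \<oplus>\<^bsub>S\<^esub> ?s"
      by (subst atLeastAtMostSuc_conv, simp, subst Rcl.S.finsum_insert) simp_all
    have "V \<oplus>\<^bsub>S\<^esub> V \<otimes>\<^bsub>S\<^esub> (V [^]\<^bsub>S\<^esub> Suc m \<oplus>\<^bsub>S\<^esub> ?s) = V [^]\<^bsub>S\<^esub> Suc (Suc m) \<oplus>\<^bsub>S\<^esub> (V \<oplus>\<^bsub>S\<^esub> V \<otimes>\<^bsub>S\<^esub> ?s)"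
      using s by (simp add: Rcl.S.r_distr Rcl.S.a_lcomm Rcl.S.m_comm)
    then show ?case unfolding ins Suc .
  qed simp
  from this[of r] have "V \<oplus>\<^bsub>S\<^esub> V \<otimes>\<^bsub>S\<^esub> T = V \<oplus>\<^bsub>S\<^esub> T"
    unfolding V_pow_Suc_r T_def[symmetric] .
  then have "\<ominus>\<^bsub>S\<^esub> V \<oplus>\<^bsub>S\<^esub> (V \<oplus>\<^bsub>S\<^esub> V \<otimes>\<^bsub>S\<^esub> T) = \<ominus>\<^bsub>S\<^esub> V \<oplus>\<^bsub>S\<^esub> (V \<oplus>\<^bsub>S\<^esub> T)" by simp
  then show ?thesis by (simp only: Rcl.S.r_neg1 Rcl.S.m_closed V_closed T_closed)
qed

lemma V_pow_mult_T: "V [^]\<^bsub>S\<^esub> (j::nat) \<otimes>\<^bsub>S\<^esub> T = T"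
  by (induction j) (simp_all add: Rcl.S.m_assoc V_mult_T)

lemma T_mult_T: "T \<otimes>\<^bsub>S\<^esub> T = \<kappa> ([r] \<cdot> \<one>) \<otimes>\<^bsub>S\<^esub> T"
proof -
  \<comment> \<open>Only the left factor is truncated at m; the full \<open>T\<close> on the right
    absorbs each power of v.\<close>
  have *: "(\<Oplus>\<^bsub>S\<^esub>j\<in>{1..m}. V [^]\<^bsub>S\<^esub> j) \<otimes>\<^bsub>S\<^esub> T = \<kappa> ([m] \<cdot> \<one>) \<otimes>\<^bsub>S\<^esub> T" for m :: nat
  proof (induction m)
    case (Suc m)
    let ?s = "\<Oplus>\<^bsub>S\<^esub>j\<in>{1..m}. V [^]\<^bsub>S\<^esub> j"
    have s: "?s \<in> carrier S" by (intro Rcl.S.finsum_closed) simp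
    have ins: "(\<Oplus>\<^bsub>S\<^esub>j\<in>{1..Suc m}. V [^]\<^bsub>S\<^esub> j) = V [^]\<^bsub>S\<^esub> Suc m \<oplus>\<^bsub>S\<^esub> ?s"
      by (subst atLeastAtMostSuc_conv, simp, subst Rcl.S.finsum_insert) simp_all
    have "(V [^]\<^bsub>S\<^esub> Suc m \<oplus>\<^bsub>S\<^esub> ?s) \<otimes>\<^bsub>S\<^esub> T = T \<oplus>\<^bsub>S\<^esub> \<kappa> ([m] \<cdot> \<one>) \<otimes>\<^bsub>S\<^esub> T"
      using s V_pow_mult_T[of "Suc m"] Suc by (simp add: Rcl.S.l_distr del: Rcl.S.nat_pow_Suc)
    also have "\<dots> = \<kappa> ([Suc m] \<cdot> \<one>) \<otimes>\<^bsub>S\<^esub> T"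
      by (simp add: Rcl.S.l_distr Rcl.S.a_comm)
    finally show ?case unfolding ins .
  qed simp
  show ?thesis using *[of r] unfolding T_def[symmetric] .
qed

lemma \<kappa>_\<rho>_r: "\<kappa> \<rho> \<otimes>\<^bsub>S\<^esub> \<kappa> ([r] \<cdot> \<one>) = \<one>\<^bsub>S\<^esub>"
  using r_unit by (simp add: \<kappa>.hom_mult[symmetric] del: \<kappa>.hom_mult)

lemma e1_eq: "e1 F r = \<kappa> \<rho> \<otimes>\<^bsub>S\<^esub> T"
  by (simp add: e1_def T_def)

lemma e2_eq: "e2 F r = V [^]\<^bsub>S\<^esub> r \<ominus>\<^bsub>S\<^esub> e1 F r"
proof -
  let ?T' = "\<Oplus>\<^bsub>S\<^esub>j\<in>{1..r - 1}. V [^]\<^bsub>S\<^esub> j"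
  obtain m where m: "r = Suc m" using r_pos by (cases r) auto
  have T': "?T' \<in> carrier S" by (intro Rcl.S.finsum_closed) simp
  have T: "T = V [^]\<^bsub>S\<^esub> r \<oplus>\<^bsub>S\<^esub> ?T'"
  proof -
    have "{1..r} = insert r {1..r - 1}" using r_pos by auto
    then show ?thesis unfolding T_def using r_pos by (simp add: Rcl.S.finsum_insert)
  qed
  \<comment> \<open>This leads to (r - 1)/r = 1 - 1/r. The part -1/r of the coefficient of v^r
    completes the sum up to r - 1 to -T/r = -\<open>e1\<close>.\<close>
  have "[r] \<cdot> \<one> = ([(r - 1)] \<cdot> \<one>) \<oplus> \<one>" using m by simp
  then have "[(r - 1)] \<cdot> \<one> = ([r] \<cdot> \<one>) \<ominus> \<one>" by (simp add: minus_eq a_assoc r_neg)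
  then have "([(r - 1)] \<cdot> \<one>) \<otimes> \<rho> = \<one> \<ominus> \<rho>"
    using r_unit by (simp add: minus_eq l_distr l_minus)
  then have "e2 F r = \<ominus>\<^bsub>S\<^esub> (\<kappa> \<rho> \<otimes>\<^bsub>S\<^esub> ?T') \<oplus>\<^bsub>S\<^esub> (\<one>\<^bsub>S\<^esub> \<ominus>\<^bsub>S\<^esub> \<kappa> \<rho>) \<otimes>\<^bsub>S\<^esub> V [^]\<^bsub>S\<^esub> r"
    unfolding e2_def by (simp add: minus_eq Rcl.S.minus_eq)
  also have "\<dots> = V [^]\<^bsub>S\<^esub> r \<ominus>\<^bsub>S\<^esub> \<kappa> \<rho> \<otimes>\<^bsub>S\<^esub> T"
    unfolding T using T'
    by (simp add: Rcl.S.minus_eq Rcl.S.l_distr Rcl.S.r_distr Rcl.S.l_minus Rcl.S.minus_add Rcl.S.a_ac)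
  finally show ?thesis by (simp add: e1_eq)
qed

lemma e_orthogonal: "orthogonal_idempotents S (e1 F r) (e2 F r) (e3 F r)"
proof -
  have e1c: "e1 F r \<in> carrier S" by (simp add: e1_eq)
  have "e1 F r \<otimes>\<^bsub>S\<^esub> e1 F r = \<kappa> \<rho> \<otimes>\<^bsub>S\<^esub> \<kappa> \<rho> \<otimes>\<^bsub>S\<^esub> (T \<otimes>\<^bsub>S\<^esub> T)"
    unfolding e1_eq by (simp add: Rcl.S.m_ac)
  also have "\<dots> = (\<kappa> \<rho> \<otimes>\<^bsub>S\<^esub> \<kappa> ([r] \<cdot> \<one>)) \<otimes>\<^bsub>S\<^esub> (\<kappa> \<rho> \<otimes>\<^bsub>S\<^esub> T)"
    unfolding T_mult_T by (simp add: Rcl.S.m_ac)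
  finally have i: "e1 F r \<otimes>\<^bsub>S\<^esub> e1 F r = e1 F r" unfolding \<kappa>_\<rho>_r by (simp add: e1_eq)
  have e1w: "e1 F r \<otimes>\<^bsub>S\<^esub> V [^]\<^bsub>S\<^esub> r = e1 F r"
    using V_pow_mult_T[of r] unfolding e1_eq by (simp add: Rcl.S.m_assoc Rcl.S.m_comm[of T])
  obtain m where m: "r = Suc m" using r_pos by (cases r) auto
  \<comment> \<open>With m = r - 1, v^(2r) is split as v^(r+1) v^(r-1), so that v^(r+1) = v reduces
    it to v^r.\<close>
  have "V [^]\<^bsub>S\<^esub> r \<otimes>\<^bsub>S\<^esub> V [^]\<^bsub>S\<^esub> r = V [^]\<^bsub>S\<^esub> Suc r \<otimes>\<^bsub>S\<^esub> V [^]\<^bsub>S\<^esub> m"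
    using Rcl.S.nat_pow_mult[of V r r] Rcl.S.nat_pow_mult[of V "Suc r" m] m by (metis V_closed add_Suc add_Suc_right)
  also have "\<dots> = V [^]\<^bsub>S\<^esub> r"
    using Rcl.S.nat_pow_Suc[of V m] unfolding m[symmetric] V_pow_Suc_r by (simp add: Rcl.S.m_comm)
  finally have "V [^]\<^bsub>S\<^esub> r \<otimes>\<^bsub>S\<^esub> V [^]\<^bsub>S\<^esub> r = V [^]\<^bsub>S\<^esub> r" .
  then show ?thesis
    using Rcl.S.orthogonal_idempotents_chain[OF e1c _ i _ e1w] unfolding e2_eq e3_def by simp
qed

sublocale e: orthogonal_idempotents S "e1 F r" "e2 F r" "e3 F r"
  by (rule e_orthogonal)

section \<open>The subring \<open>R\<close> and its idempotents\<close>

abbreviation R where "R \<equiv> R_sub F r"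

lemma e_comb_eq: "e_comb F r a b c = e.comb (\<kappa> a) (\<kappa> b) (\<kappa> c)"
  by (simp add: e_comb_def e.comb_def)

lemma R_carrier: "carrier R = {e.comb (\<kappa> a) (\<kappa> b) (\<kappa> c) |a b c. a \<in> carrier F \<and> b \<in> carrier F \<and> c \<in> carrier F}"
  by (simp add: R_sub_def e_comb_eq)

lemma R_carrierI:
  "a \<in> carrier F \<Longrightarrow> b \<in> carrier F \<Longrightarrow> c \<in> carrier F \<Longrightarrow> e.comb (\<kappa> a) (\<kappa> b) (\<kappa> c) \<in> carrier R"
  unfolding R_carrier by blast

text \<open>All operations act componentwise on combinations of the idempotents, and 1 has
  components 1, 1, 1.\<close>

lemma R_subring: "subring (carrier R) S"
proof (rule Rcl.S.subringI)
  show "carrier R \<subseteq> carrier S" unfolding R_carrier by (rule subsetI, elim CollectE exE conjE) simp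
  have "e.comb (\<kappa> \<one>) (\<kappa> \<one>) (\<kappa> \<one>) = \<one>\<^bsub>S\<^esub>" by (simp add: e.comb_const)
  then show "\<one>\<^bsub>S\<^esub> \<in> carrier R" using R_carrierI[OF one_closed one_closed one_closed] by simp
  fix x assume "x \<in> carrier R"
  then obtain a b c where x: "a \<in> carrier F" "b \<in> carrier F" "c \<in> carrier F"
    "x = e.comb (\<kappa> a) (\<kappa> b) (\<kappa> c)"
    unfolding R_carrier by (elim CollectE exE conjE)
  have "\<ominus>\<^bsub>S\<^esub> x = e.comb (\<kappa> (\<ominus> a)) (\<kappa> (\<ominus> b)) (\<kappa> (\<ominus> c))"
    unfolding x(4) using x(1-3) by (simp add: e.comb_minus)
  then show "\<ominus>\<^bsub>S\<^esub> x \<in> carrier R" using x(1-3) R_carrierI[of "\<ominus> a" "\<ominus> b" "\<ominus> c"] by simp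
  fix y assume "y \<in> carrier R"
  then obtain a' b' c' where y: "a' \<in> carrier F" "b' \<in> carrier F" "c' \<in> carrier F"
    "y = e.comb (\<kappa> a') (\<kappa> b') (\<kappa> c')"
    unfolding R_carrier by (elim CollectE exE conjE)
  have "x \<otimes>\<^bsub>S\<^esub> y = e.comb (\<kappa> (a \<otimes> a')) (\<kappa> (b \<otimes> b')) (\<kappa> (c \<otimes> c'))"
    unfolding x(4) y(4) using x(1-3) y(1-3) by (simp add: e.comb_mult)
  then show "x \<otimes>\<^bsub>S\<^esub> y \<in> carrier R"
    using x(1-3) y(1-3) R_carrierI[of "a \<otimes> a'" "b \<otimes> b'" "c \<otimes> c'"] by simp
  have "x \<oplus>\<^bsub>S\<^esub> y = e.comb (\<kappa> (a \<oplus> a')) (\<kappa> (b \<oplus> b')) (\<kappa> (c \<oplus> c'))"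
    unfolding x(4) y(4) using x(1-3) y(1-3) by (simp add: e.comb_add)
  then show "x \<oplus>\<^bsub>S\<^esub> y \<in> carrier R"
    using x(1-3) y(1-3) R_carrierI[of "a \<oplus> a'" "b \<oplus> b'" "c \<oplus> c'"] by simp
qed

lemma R_ops [simp]:
  "monoid.mult R = monoid.mult S" "one R = one S" "zero R = zero S" "add R = add S"
  by (simp_all add: R_sub_def)

lemma R_cring: "cring R"
proof -
  have "cring (S\<lparr>carrier := carrier R\<rparr>)"
    using Rcl.S.subcring_iff[OF subringE(1)] Rcl.S.subcringI' R_subring by blast
  then show ?thesis by (simp add: R_sub_def)
qed

text \<open>Because the idempotents sum to 1, a scalar is the combination with three equal
  coefficients, so it lies in \<open>R\<close>.\<close>

lemma \<kappa>_R_hom: "ring_hom_cring F R \<kappa>"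
proof -
  have "\<kappa> a \<in> carrier R" if "a \<in> carrier F" for a
    using R_carrierI[OF that that that] that by (simp add: e.comb_const)
  then have "\<kappa> \<in> ring_hom F R" by (intro ring_hom_memI) simp_all
  then show ?thesis using R_cring is_cring by (simp add: ring_hom_cring_def ring_hom_cring_axioms_def)
qed

lemma e_orthogonal_R: "orthogonal_idempotents R (e1 F r) (e2 F r) (e3 F r)"
proof -
  interpret R: cring R by (rule R_cring)
  \<comment> \<open>Exhibits the idempotents as elements of the subring; their relations are
    inherited from the full ring.\<close>
  have "e.comb (\<kappa> \<one>) (\<kappa> \<zero>) (\<kappa> \<zero>) = e1 F r" "e.comb (\<kappa> \<zero>) (\<kappa> \<one>) (\<kappa> \<zero>) = e2 F r"
    "e.comb (\<kappa> \<zero>) (\<kappa> \<zero>) (\<kappa> \<one>) = e3 F r"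
    by (simp_all add: e.comb_def)
  then have "e1 F r \<in> carrier R" "e2 F r \<in> carrier R" "e3 F r \<in> carrier R"
    using R_carrierI[of \<one> \<zero> \<zero>] R_carrierI[of \<zero> \<one> \<zero>] R_carrierI[of \<zero> \<zero> \<one>] by simp_all
  then show ?thesis
    by unfold_locales (simp_all add: e.idem e.orth e.sum_one)
qed

end

section \<open>The codes\<close>

locale split_cyc = split_ring F r for F (structure) and r :: nat +
  fixes n :: nat
  assumes n_pos: "0 < n"
begin

sublocale CF: cyc F n
  using is_cring n_pos by (simp add: cyc_def cyc_axioms_def)

sublocale CR: cyc R n
  using R_cring n_pos by (simp add: cyc_def cyc_axioms_def)

sublocale E: orthogonal_idempotents CR.Q "CR.K (e1 F r)" "CR.K (e2 F r)" "CR.K (e3 F r)"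
  by (rule CR.K.orthogonal_idempotents_image[OF e_orthogonal_R])

text \<open>Extension of scalars from F[x]/(x^n - 1) to R[x]/(x^n - 1), the second factor in
  \<open>lift_mult\<close>.\<close>

definition lift where
  "lift = induced_eval F CR.Q (\<lambda>a. CR.K (\<kappa> a)) CR.X"

lemma const_hom: "ring_hom_cring F CR.Q (\<lambda>a. CR.K (\<kappa> a))"
proof -
  interpret k: ring_hom_cring F R \<kappa> by (rule \<kappa>_R_hom)
  have "(\<lambda>a. CR.K (\<kappa> a)) \<in> ring_hom F CR.Q"
    using ring_hom_trans[OF k.homh CR.K.homh] by (simp add: comp_def)
  then show ?thesis
    using is_cring CR.cl.S.is_cring by (simp add: ring_hom_cring_def ring_hom_cring_axioms_def)
qed

sublocale lift: ring_hom_cring CF.Q CR.Q lift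
  unfolding lift_def by (rule CF.cyc_induced_eval_hom[OF const_hom CR.X_closed CR.X_pow_n])

lemma lift_K: "a \<in> carrier F \<Longrightarrow> lift (CF.K a) = CR.K (\<kappa> a)"
  unfolding lift_def by (rule CF.cyc_induced_eval_const[OF const_hom CR.X_closed CR.X_pow_n])

lemma lift_X: "lift CF.X = CR.X"
  unfolding lift_def by (rule CF.cyc_induced_eval_X[OF const_hom CR.X_closed CR.X_pow_n])

lemma lift_mult_eq: "lift_mult F r n e g = CR.K e \<otimes>\<^bsub>CR.Q\<^esub> lift g"
  by (simp add: lift_mult_def lift_def)

text \<open>Both sides are homomorphisms in g; they fix the embedded constants and send x to
  x^(n-1), so they agree everywhere.\<close>

lemma cyc_inv_lift:
  assumes "g \<in> carrier CF.Q"
  shows "cyc_inv R n (lift g) = lift (cyc_inv F n g)"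
proof (rule CF.cyc_hom_ext[OF _ _ _ _ assms])
  interpret k: ring_hom_cring F R \<kappa> by (rule \<kappa>_R_hom)
  have "(\<lambda>g. cyc_inv R n (lift g)) \<in> ring_hom CF.Q CR.Q" "(\<lambda>g. lift (cyc_inv F n g)) \<in> ring_hom CF.Q CR.Q"
    using ring_hom_trans[OF lift.homh CR.inv.homh] ring_hom_trans[OF CF.inv.homh lift.homh]
    by (simp_all add: comp_def)
  then show "ring_hom_cring CF.Q CR.Q (\<lambda>g. cyc_inv R n (lift g))"
    "ring_hom_cring CF.Q CR.Q (\<lambda>g. lift (cyc_inv F n g))"
    using CF.cl.S.is_cring CR.cl.S.is_cring
    by (simp_all add: ring_hom_cring_def ring_hom_cring_axioms_def)
  show "cyc_inv R n (lift (CF.K a)) = lift (cyc_inv F n (CF.K a))" if "a \<in> carrier F" for a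
    using that by (simp add: lift_K)
  show "cyc_inv R n (lift CF.X) = lift (cyc_inv F n CF.X)"
    by (simp add: lift_X CF.cyc_inv_X CR.cyc_inv_X)
qed

theorem split_cyclic_code:
  assumes C: "C \<subseteq> CR.words"
    and gen: "code_generated_by R n C
      {lift_mult F r n (e1 F r) g1, lift_mult F r n (e2 F r) g2, lift_mult F r n (e3 F r) g3}"
    and g1: "cyc_idempotent F n g1" and g2: "cyc_idempotent F n g2" and g3: "cyc_idempotent F n g3"
  shows "code_generated_by R n C
      {lift_mult F r n (e1 F r) g1 \<oplus>\<^bsub>CR.Q\<^esub> lift_mult F r n (e2 F r) g2 \<oplus>\<^bsub>CR.Q\<^esub>
       lift_mult F r n (e3 F r) g3}" (is ?gen)
    and "idempotent_generator R n (dual_code R n C) g \<longleftrightarrow>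
      g = \<one>\<^bsub>CR.Q\<^esub> \<ominus>\<^bsub>CR.Q\<^esub> lift_mult F r n (e1 F r) (cyc_inv F n g1)
        \<ominus>\<^bsub>CR.Q\<^esub> lift_mult F r n (e2 F r) (cyc_inv F n g2)
        \<ominus>\<^bsub>CR.Q\<^esub> lift_mult F r n (e3 F r) (cyc_inv F n g3)" (is ?dual)
proof -
  have c: "g1 \<in> carrier CF.Q" "g2 \<in> carrier CF.Q" "g3 \<in> carrier CF.Q"
    and i: "g1 \<otimes>\<^bsub>CF.Q\<^esub> g1 = g1" "g2 \<otimes>\<^bsub>CF.Q\<^esub> g2 = g2" "g3 \<otimes>\<^bsub>CF.Q\<^esub> g3 = g3"
    using g1 g2 g3 unfolding cyc_idempotent_def by simp_all
  \<comment> \<open>The single generator \<open>e1\<close> g1 + \<open>e2\<close> g2 +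
    \<open>e3\<close> g3. It is idempotent because combinations multiply componentwise and
    \<open>lift\<close> preserves products.\<close>
  define G where "G = E.comb (lift g1) (lift g2) (lift g3)"
  have "Idl\<^bsub>CR.Q\<^esub> {lift_mult F r n (e1 F r) g1, lift_mult F r n (e2 F r) g2, lift_mult F r n (e3 F r) g3} =
      Idl\<^bsub>CR.Q\<^esub> {G}"
    unfolding lift_mult_eq G_def by (rule E.genideal_comb) (simp_all add: c)
  then have genG: "code_generated_by R n C {G}" using gen by (simp add: code_generated_by_def)
  then show ?gen by (simp add: G_def E.comb_def lift_mult_eq)
  have "G \<otimes>\<^bsub>CR.Q\<^esub> G = G"
    unfolding G_def using c by (simp add: E.comb_mult lift.hom_mult[symmetric] i del: lift.hom_mult)
  then have idemG: "cyc_idempotent R n G" using c by (simp add: cyc_idempotent_def G_def)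
  have e: "e1 F r \<in> carrier R" "e2 F r \<in> carrier R" "e3 F r \<in> carrier R"
    using e_orthogonal_R by (simp_all add: orthogonal_idempotents_def orthogonal_idempotents_axioms_def)
  \<comment> \<open>Inversion fixes the constants \<open>e1\<close>, \<open>e2\<close>,
    \<open>e3\<close>, which requires them to lie in \<open>R\<close>, and passes through
    \<open>lift\<close> to the g_i.\<close>
  have "cyc_inv R n G = E.comb (lift (cyc_inv F n g1)) (lift (cyc_inv F n g2)) (lift (cyc_inv F n g3))"
    unfolding G_def E.comb_def using c e by (simp add: cyc_inv_lift)
  then have "\<one>\<^bsub>CR.Q\<^esub> \<ominus>\<^bsub>CR.Q\<^esub> cyc_inv R n G =
      \<one>\<^bsub>CR.Q\<^esub> \<ominus>\<^bsub>CR.Q\<^esub> lift_mult F r n (e1 F r) (cyc_inv F n g1)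
        \<ominus>\<^bsub>CR.Q\<^esub> lift_mult F r n (e2 F r) (cyc_inv F n g2)
        \<ominus>\<^bsub>CR.Q\<^esub> lift_mult F r n (e3 F r) (cyc_inv F n g3)"
    using c e by (simp add: E.comb_def lift_mult_eq CR.cl.S.minus_eq CR.cl.S.minus_add CR.cl.S.a_ac)
  then show ?dual using CR.dual_idempotent_generator[OF C genG idemG] by simp
qed

end

text \<open>The arithmetic hypotheses place the data in \<open>split_cyc\<close>: r becomes a unit
  of \<open>F\<close>, and n is positive.\<close>

theorem corollary5:
  fixes F :: "('a, 'm) ring_scheme"
    and p k r n :: nat
    and C :: "(nat \<Rightarrow> (nat \<Rightarrow> 'a) set) set"
    and g1 g2 g3 :: "(nat \<Rightarrow> 'a) set"
  assumes "prime p" and "k \<ge> 1" and "r > 1" and "coprime r p" and "coprime n p"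
    and "field F" and "order F = p ^ k"
    and "cyclic_code (R_sub F r) n C"
    and "code_generated_by (R_sub F r) n C
           {lift_mult F r n (e1 F r) g1, lift_mult F r n (e2 F r) g2, lift_mult F r n (e3 F r) g3}"
    and "cyc_idempotent F n g1" and "cyc_idempotent F n g2" and "cyc_idempotent F n g3"
    and "code_generated_by F n (assoc_code1 F r n C) {g1}"
    and "code_generated_by F n (assoc_code2 F r n C) {g2}"
    and "code_generated_by F n (assoc_code3 F r n C) {g3}"
  shows "code_generated_by (R_sub F r) n C
           {lift_mult F r n (e1 F r) g1 \<oplus>\<^bsub>cyc_ring (R_sub F r) n\<^esub>
            lift_mult F r n (e2 F r) g2 \<oplus>\<^bsub>cyc_ring (R_sub F r) n\<^esub>
            lift_mult F r n (e3 F r) g3} \<and>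
         (\<forall>g. idempotent_generator (R_sub F r) n (dual_code (R_sub F r) n C) g \<longleftrightarrow>
           g = \<one>\<^bsub>cyc_ring (R_sub F r) n\<^esub>
             \<ominus>\<^bsub>cyc_ring (R_sub F r) n\<^esub> lift_mult F r n (e1 F r) (cyc_inv F n g1)
             \<ominus>\<^bsub>cyc_ring (R_sub F r) n\<^esub> lift_mult F r n (e2 F r) (cyc_inv F n g2)
             \<ominus>\<^bsub>cyc_ring (R_sub F r) n\<^esub> lift_mult F r n (e3 F r) (cyc_inv F n g3))"
proof -
  interpret F: field F by fact
  have "0 < p" using \<open>prime p\<close> by (rule prime_gt_0_nat)
  \<comment> \<open>An infinite carrier would have order 0, so a positive order yields
    finiteness.\<close>
  then have "0 < order F" using \<open>order F = p ^ k\<close> by simp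
  then have "finite (carrier F)" unfolding order_def by (rule card_ge_0_finite)
  moreover have "coprime r (order F)" using \<open>coprime r p\<close> \<open>order F = p ^ k\<close> by simp
  ultimately have "[r] \<cdot>\<^bsub>F\<^esub> \<one>\<^bsub>F\<^esub> \<noteq> \<zero>\<^bsub>F\<^esub>"
    using F.one_eq_zero_of_coprime_order F.one_not_zero by blast
  then have "[r] \<cdot>\<^bsub>F\<^esub> \<one>\<^bsub>F\<^esub> \<in> Units F" by (simp add: F.field_Units)
  \<comment> \<open>For n = 0, coprimality with p would make the prime p a unit.\<close>
  moreover have "n \<noteq> 0"
    using \<open>coprime n p\<close> \<open>prime p\<close> by (metis coprime_0_left_iff not_prime_unit)
  ultimately interpret split_cyc F r n
    using \<open>r > 1\<close> F.is_cring
    by (simp add: split_cyc_def split_ring_def split_ring_axioms_def split_cyc_axioms_def)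
  have "C \<subseteq> carrier (word_module R n)"
    using \<open>cyclic_code R n C\<close> unfolding cyclic_code_def
    by (simp add: submodule_def subgroup_def)
  then have C: "C \<subseteq> CR.words" by (simp add: word_module_def)
  show ?thesis
    using split_cyclic_code[OF C assms(9-12)] by blast
qed

end
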